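(* Let $k\ge1$, let $\nabla\mathcal F_k$ be the MICE gradient estimator for the minimization of $F(\boldsymbol\xi)=\mathbb E[f(\boldsymbol\xi,\boldsymbol\theta)]$ (see context), and let $\mathcal L_k^\cap=\mathcal L_k\cap\mathcal L_{k-1}$. Define the bias $$\boldsymbol b_k=\mathbb E\big[\nabla\mathcal F_k\,\big|\,\{\boldsymbol\xi_{\ell'}\}_{\ell'\in\mathcal L_k}\big]-\nabla F(\boldsymbol\xi_k).$$ Then $$\boldsymbol b_k=\sum_{\ell\in\mathcal L_k^\cap}\frac{M_{\ell,k-1}}{M_{\ell,k}}\big(\hat{\boldsymbol\mu}_{\ell,k-1}-\boldsymbol\mu_{\ell,k-1}\big),$$ and its contribution to the squared $L^2$ error is $$\mathbb E\|\boldsymbol b_k\|^2=\mathbb E\left[\sum_{\ell\in\mathcal L_k^\cap}\frac{M_{\ell,k-1}}{M_{\ell,k}^2}V_{\ell,k-1}\right].$$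
   Context: $\boldsymbol\theta\sim\pi$ is a random vector whose law $\pi$ does not depend on $\boldsymbol\xi\in\mathbb R^d$; $\nabla F(\boldsymbol\xi)=\mathbb E[\nabla_{\boldsymbol\xi}f(\boldsymbol\xi,\boldsymbol\theta)]$; all gradients involved are square integrable. Index sets: $\mathcal L_0=\{0\}$ and $k\in\mathcal L_k\subset\mathcal L_{k-1}\cup\{k\}\subset\{0,\dots,k\}$. For $\ell\in\mathcal L_k$, $\ell>\min\mathcal L_k$, let $p_k(\ell)=\max\{\ell'\in\mathcal L_k:\ell'<\ell\}$. Set $\Delta_{\ell,k}(\boldsymbol\theta)=\nabla_{\boldsymbol\xi} f(\boldsymbol\xi_\ell,\boldsymbol\theta)-\nabla_{\boldsymbol\xi} f(\boldsymbol\xi_{p_k(\ell)},\boldsymbol\theta)$ if $\ell>\min\mathcal L_k$, and $\Delta_{\ell,k}(\boldsymbol\theta)=\nabla_{\boldsymbol\xi} f(\boldsymbol\xi_\ell,\boldsymbol\theta)$ if $\ell=\min\mathcal L_k$. Given index sets $\mathcal L_k$ and positive integers $M_{\ell,k}$ (with $M_{\ell,k}\ge M_{\ell,k-1}$ for $\ell\in\mathcal L_k^\cap$), the MICE estimator is $$\nabla\mathcal F_k=\sum_{\ell\in\mathcal L_k}\hat{\boldsymbol\mu}_{\ell,k},\qquad\hat{\boldsymbol\mu}_{\ell,k}=\frac1{M_{\ell,k}}\sum_{\alpha\in\mathcal I_{\ell,k}}\Delta_{\ell,k}(\boldsymbol\theta_\alpha),$$ where $\mathcal I_{\ell,k}$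 indexes the first $M_{\ell,k}$ elements of a sequence of i.i.d. samples from $\pi$ attached to level $\ell$; the sequences of different levels are independent of each other and of $\boldsymbol\xi_0$. Samples are cumulative ($\mathcal I_{\ell,k-1}\subset\mathcal I_{\ell,k}$, the samples in $\mathcal I_{\ell,k}\setminus\mathcal I_{\ell,k-1}$ being drawn at iteration $k$). The iterate $\boldsymbol\xi_{k+1}$ is a deterministic function of $\boldsymbol\xi_0$ and the samples drawn at iterations $0,\dots,k$. Levels common to $\mathcal L_k$ and $\mathcal L_{k-1}$ keep their differences, $\Delta_{\ell,k}=\Delta_{\ell,k-1}$ for $\ell\in\mathcal L_k^\cap$, so that $$\nabla\mathcal F_k=\sum_{\ell\in\mathcal L_k^\cap}\frac{M_{\ell,k-1}}{M_{\ell,k}}\hat{\boldsymbol\mu}_{\ell,k-1}+\sum_{\ell\in\mathcal L_k^\cap}\frac1{M_{\ell,k}}\sum_{\alpha\in\mathcal I_{\ell,k}\setminus\mathcal I_{\ell,k-1}}\Delta_{\ell,k}(\boldsymbol\theta_\alpha)+\hat{\boldsymbol\mu}_{k,k}.$$ $\boldsymbol\mu_{\ell,k}=\nabla F(\boldsymbol\xi_\ell)-\nabla F(\boldsymbol\xi_{p_k(\ell)})$ if $\ell>\min\mathcal L_k$ and $\boldsymbol\mu_{\ell,k}=\nabla F(\boldsymbol\xi_\ell)$ if $\ell=\min\mathcal L_k$. $V_{\ell,k}$ is the sum over the $d$ components of the variances of $\Delta_{\ell,k}(\boldsymbol\theta)$ given the iterates, with $\boldsymbol\theta\sim\pi$ independent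 of the iterates. The conditional expectation $\mathbb E[\,\cdot\mid\{\boldsymbol\xi_{\ell'}\}_{\ell'\in\mathcal L_k}]$ is understood as conditioning on the whole history before iteration $k$'s sampling: the iterates and all quantities computed from samples drawn at iterations $<k$ are deterministic under it. *)

theory Defs
  imports "HOL-Probability.Probability"
begin

definition prev_level :: "(nat \<Rightarrow> nat set) \<Rightarrow> nat \<Rightarrow> nat \<Rightarrow> nat" where
  "prev_level L k l = Max {l' \<in> L k. l' < l}"

text \<open>Applied to the sampled gradient along the iterates this gives \<open>\<Delta>\<close>, applied to the gradient of
  the objective it gives \<open>\<mu>\<close>.\<close>

definition level_diff :: "(nat \<Rightarrow> nat set) \<Rightarrow> nat \<Rightarrow> nat \<Rightarrow> (nat \<Rightarrow> 'a::real_vector) \<Rightarrow> 'a" where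
  "level_diff L k l h = (if l > Min (L k) then h l - h (prev_level L k l) else h l)"

definition mice_Delta ::
  "(nat \<Rightarrow> nat set) \<Rightarrow> ('a \<Rightarrow> 't \<Rightarrow> 'a) \<Rightarrow> (nat \<Rightarrow> 'w \<Rightarrow> 'a::euclidean_space) \<Rightarrow> nat \<Rightarrow> nat \<Rightarrow> 'w \<Rightarrow> 't \<Rightarrow> 'a"
  where "mice_Delta L gradf xi l k \<omega> t = level_diff L k l (\<lambda>j. gradf (xi j \<omega>) t)"

definition mice_mu ::
  "(nat \<Rightarrow> nat set) \<Rightarrow> ('a \<Rightarrow> 'a) \<Rightarrow> (nat \<Rightarrow> 'w \<Rightarrow> 'a::euclidean_space) \<Rightarrow> nat \<Rightarrow> nat \<Rightarrow> 'w \<Rightarrow> 'a"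
  where "mice_mu L gradF xi l k \<omega> = level_diff L k l (\<lambda>j. gradF (xi j \<omega>))"

text \<open>The variances are taken over a fresh \<open>t\<close> with law \<open>\<pi>\<close>, the iterates being frozen at \<open>\<omega>\<close>.\<close>

definition mice_V ::
  "(nat \<Rightarrow> nat set) \<Rightarrow> 't measure \<Rightarrow> ('a \<Rightarrow> 't \<Rightarrow> 'a) \<Rightarrow> (nat \<Rightarrow> 'w \<Rightarrow> 'a::euclidean_space) \<Rightarrow> nat \<Rightarrow> nat \<Rightarrow> 'w \<Rightarrow> real"
  where "mice_V L \<pi> gradf xi l k \<omega> =
    (\<Sum>i\<in>Basis. prob_space.variance \<pi> (\<lambda>t. mice_Delta L gradf xi l k \<omega> t \<bullet> i))"

text \<open>\<open>N l k\<close> is the sample size $M_{\ell,k}$, and \<open>\<theta> l \<alpha>\<close> is the \<open>\<alpha>\<close>-th element of the sequence attached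
  to level \<open>l\<close>. Numbering starts at 0, so the first \<open>N l k\<close> elements are those with \<open>\<alpha> < N l k\<close>.\<close>

definition mice_mu_hat ::
  "(nat \<Rightarrow> nat set) \<Rightarrow> (nat \<Rightarrow> nat \<Rightarrow> nat) \<Rightarrow> ('a \<Rightarrow> 't \<Rightarrow> 'a) \<Rightarrow> (nat \<Rightarrow> nat \<Rightarrow> 'w \<Rightarrow> 't)
    \<Rightarrow> (nat \<Rightarrow> 'w \<Rightarrow> 'a::euclidean_space) \<Rightarrow> nat \<Rightarrow> nat \<Rightarrow> 'w \<Rightarrow> 'a"
  where "mice_mu_hat L N gradf \<theta> xi l k \<omega> =
    (1 / real (N l k)) *\<^sub>R (\<Sum>\<alpha>\<in>{..<N l k}. mice_Delta L gradf xi l k \<omega> (\<theta> l \<alpha> \<omega>))"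

definition mice_estimator ::
  "(nat \<Rightarrow> nat set) \<Rightarrow> (nat \<Rightarrow> nat \<Rightarrow> nat) \<Rightarrow> ('a \<Rightarrow> 't \<Rightarrow> 'a) \<Rightarrow> (nat \<Rightarrow> nat \<Rightarrow> 'w \<Rightarrow> 't)
    \<Rightarrow> (nat \<Rightarrow> 'w \<Rightarrow> 'a::euclidean_space) \<Rightarrow> nat \<Rightarrow> 'w \<Rightarrow> 'a"
  where "mice_estimator L N gradf \<theta> xi k \<omega> = (\<Sum>l\<in>L k. mice_mu_hat L N gradf \<theta> xi l k \<omega>)"

text \<open>Indices \<open>(l, \<alpha>)\<close> of the samples drawn at iteration \<open>k\<close>: at a level kept from iteration \<open>k - 1\<close>
  only the increment is drawn, at a new level all samples are.\<close>

definition drawn_at :: "(nat \<Rightarrow> nat set) \<Rightarrow> (nat \<Rightarrow> nat \<Rightarrow> nat) \<Rightarrow> nat \<Rightarrow> (nat \<times> nat) set" where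
  "drawn_at L N k = (SIGMA l:L k.
     if 0 < k \<and> l \<in> L (k - 1) then {..<N l k} - {..<N l (k - 1)} else {..<N l k})"

definition drawn_before :: "(nat \<Rightarrow> nat set) \<Rightarrow> (nat \<Rightarrow> nat \<Rightarrow> nat) \<Rightarrow> nat \<Rightarrow> (nat \<times> nat) set" where
  "drawn_before L N k = (\<Union>j<k. drawn_at L N j)"

definition past_data ::
  "(nat \<Rightarrow> nat set) \<Rightarrow> (nat \<Rightarrow> nat \<Rightarrow> nat) \<Rightarrow> (nat \<Rightarrow> nat \<Rightarrow> 'w \<Rightarrow> 't) \<Rightarrow> (nat \<Rightarrow> 'w \<Rightarrow> 'a)
    \<Rightarrow> nat \<Rightarrow> 'w \<Rightarrow> 'a \<times> (nat \<times> nat \<Rightarrow> 't)"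
  where "past_data L N \<theta> xi k \<omega> =
    (xi 0 \<omega>, \<lambda>p\<in>drawn_before L N k. \<theta> (fst p) (snd p) \<omega>)"

definition past_space ::
  "(nat \<Rightarrow> nat set) \<Rightarrow> (nat \<Rightarrow> nat \<Rightarrow> nat) \<Rightarrow> 't measure \<Rightarrow> nat \<Rightarrow> ('a::euclidean_space \<times> (nat \<times> nat \<Rightarrow> 't)) measure"
  where "past_space L N \<pi> k = borel \<Otimes>\<^sub>M Pi\<^sub>M (drawn_before L N k) (\<lambda>_. \<pi>)"

text \<open>The \<open>\<sigma>\<close>-algebra generated by the initial iterate and the samples drawn before iteration \<open>k\<close>.\<close>

definition history ::
  "'w measure \<Rightarrow> (nat \<Rightarrow> nat set) \<Rightarrow> (nat \<Rightarrow> nat \<Rightarrow> nat) \<Rightarrow> 't measure \<Rightarrow> (nat \<Rightarrow> nat \<Rightarrow> 'w \<Rightarrow> 't)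
    \<Rightarrow> (nat \<Rightarrow> 'w \<Rightarrow> 'a::euclidean_space) \<Rightarrow> nat \<Rightarrow> 'w measure"
  where "history M L N \<pi> \<theta> xi k =
    vimage_algebra (space M) (past_data L N \<theta> xi k) (past_space L N \<pi> k)"

text \<open>The library's conditional expectation is real-valued; vectors are treated componentwise.\<close>

definition vec_cond_exp :: "'w measure \<Rightarrow> 'w measure \<Rightarrow> ('w \<Rightarrow> 'a::euclidean_space) \<Rightarrow> 'w \<Rightarrow> 'a" where
  "vec_cond_exp M \<H> X \<omega> = (\<Sum>i\<in>Basis. real_cond_exp M \<H> (\<lambda>\<omega>'. X \<omega>' \<bullet> i) \<omega> *\<^sub>R i)"

definition mice_bias ::
  "'w measure \<Rightarrow> 't measure \<Rightarrow> (nat \<Rightarrow> nat set) \<Rightarrow> (nat \<Rightarrow> nat \<Rightarrow> nat) \<Rightarrow> ('a \<Rightarrow> 't \<Rightarrow> 'a) \<Rightarrow> ('a \<Rightarrow> 'a)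
    \<Rightarrow> (nat \<Rightarrow> nat \<Rightarrow> 'w \<Rightarrow> 't) \<Rightarrow> (nat \<Rightarrow> 'w \<Rightarrow> 'a::euclidean_space) \<Rightarrow> nat \<Rightarrow> 'w \<Rightarrow> 'a"
  where "mice_bias M \<pi> L N gradf gradF \<theta> xi k \<omega> =
    vec_cond_exp M (history M L N \<pi> \<theta> xi k) (mice_estimator L N gradf \<theta> xi k) \<omega> - gradF (xi k \<omega>)"

locale mice_setting = prob_space M
  for M :: "'w measure" +
  fixes \<pi> :: "'t measure"
    and f :: "'a::euclidean_space \<Rightarrow> 't \<Rightarrow> real"
    and gradf :: "'a \<Rightarrow> 't \<Rightarrow> 'a"
    and gradF :: "'a \<Rightarrow> 'a"
    and L :: "nat \<Rightarrow> nat set"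
    and N :: "nat \<Rightarrow> nat \<Rightarrow> nat"
    and \<theta> :: "nat \<Rightarrow> nat \<Rightarrow> 'w \<Rightarrow> 't"
    and xi :: "nat \<Rightarrow> 'w \<Rightarrow> 'a"
  assumes prob_space_pi: "prob_space \<pi>"
    and f_measurable: "(\<lambda>(x, t). f x t) \<in> borel_measurable (borel \<Otimes>\<^sub>M \<pi>)"
    and f_integrable: "\<And>x. integrable \<pi> (f x)"
    and gradf: "\<And>x t. t \<in> space \<pi> \<Longrightarrow> GDERIV (\<lambda>y. f y t) x :> gradf x t"
    and gradF: "\<And>x. GDERIV (\<lambda>y. \<integral>t. f y t \<partial>\<pi>) x :> gradF x"
    and gradf_integrable: "\<And>x. integrable \<pi> (gradf x)"
    and gradF_eq: "\<And>x. gradF x = (\<integral>t. gradf x t \<partial>\<pi>)"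
    and L_0: "L 0 = {0}"
    and L_self: "\<And>k. 1 \<le> k \<Longrightarrow> k \<in> L k"
    and L_subset: "\<And>k. 1 \<le> k \<Longrightarrow> L k \<subseteq> L (k - 1) \<union> {k}"
    and N_pos: "\<And>k l. l \<in> L k \<Longrightarrow> 0 < N l k"
    and N_mono: "\<And>k l. 1 \<le> k \<Longrightarrow> l \<in> L k \<inter> L (k - 1) \<Longrightarrow> N l (k - 1) \<le> N l k"
    and samples_distr: "\<And>l \<alpha>. distr M \<pi> (\<theta> l \<alpha>) = \<pi>"
    and samples_indep: "\<And>l. indep_vars (\<lambda>_. \<pi>) (\<theta> l) UNIV"
    \<comment> \<open>The sample sequences of the levels and \<open>xi 0\<close> are mutually independent. The latter takes
      values in another type, so independence is expressed through the generated \<open>\<sigma>\<close>-algebras;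
      index \<open>None\<close> stands for \<open>xi 0\<close> and \<open>Some l\<close> for the sequence of level \<open>l\<close>.\<close>
    and levels_indep: "indep_sets
      (case_option
        (sets (vimage_algebra (space M) (xi 0) borel))
        (\<lambda>l. sets (vimage_algebra (space M) (\<lambda>\<omega> \<alpha>. \<theta> l \<alpha> \<omega>) (Pi\<^sub>M UNIV (\<lambda>_. \<pi>)))))
      UNIV"
    and xi_0_measurable: "xi 0 \<in> borel_measurable M"
    and xi_Suc: "\<And>k. \<exists>g \<in> borel_measurable (past_space L N \<pi> (Suc k)).
      \<forall>\<omega>\<in>space M. xi (Suc k) \<omega> = g (past_data L N \<theta> xi (Suc k) \<omega>)"
    \<comment> \<open>On the product space the second coordinate has law \<open>\<pi>\<close> and is independent of the iterates.\<close>
    and gradf_square_integrable: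
      "\<And>l. integrable (M \<Otimes>\<^sub>M \<pi>) (\<lambda>(\<omega>, t). (norm (gradf (xi l \<omega>) t))\<^sup>2)"

end

theory Submission
  imports Defs
begin

text \<open>Write $k = m + 1$ and let $\mathcal H$ be the \<open>\<sigma>\<close>-algebra of the initial iterate and of the samples
  drawn before iteration $k$. The estimator is a finite linear combination of the terms
  $\Delta_{\ell,k}(\theta_{\ell,\alpha})$, and all iterates that occur in it are
  $\mathcal H$-measurable. If $\theta_{\ell,\alpha}$ was drawn before iteration $k$, conditioning
  leaves the term unchanged. If it is drawn at iteration $k$, it is independent of $\mathcal H$, so
  conditioning integrates it against \<open>\<pi>\<close> and gives $\mu_{\ell,k}$ (\<open>cond_exp_Delta_sample\<close>). Since
  $\nabla F(\xi_k)$ is the telescoping sum of the $\mu_{\ell,k}$ (\<open>sum_level_diff\<close>), subtracting it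
  removes the new samples and leaves, from the old ones, the sum of
  $(\Delta_{\ell,k}(\theta_{\ell,\alpha}) - \mu_{\ell,k}) / M_{\ell,k}$ over the common levels and
  $\alpha < M_{\ell,m}$. Levels kept from iteration $m$ keep their differences, so this is the formula
  for the bias (\<open>bias_component\<close>, \<open>inherited_error_component\<close>).

  For the second moment, these summands are pairwise orthogonal in $L^2$ (\<open>centred_Delta_orthogonal\<close>),
  although the differences are evaluated at iterates that depend on many of the same samples. The
  point is that the iterates $\xi_j$ with $j \le \ell$ involve only samples of levels below
  $\ell$. Given two distinct samples, take the one of higher level $\ell$ (either one if the levels
  agree) and condition on the initial iterate and on all other samples of levels up to $\ell$: the
  other summand is then known, whereas the conditional mean of the first one vanishes. So
  $\mathbb E\|b_k\|^2$ is the sum of the individual second moments. As $\theta_{\ell,\alpha}$ is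
  independent of the iterates in its own difference, each of them is
  $\mathbb E[V_{\ell,m}] / M_{\ell,k}^2$, and level $\ell$ contributes $M_{\ell,m}$ of them.

  Both parts rest on one decoupling principle, developed in the locale \<open>fresh_sample\<close>: in an
  integrand $h(\omega, \theta(\omega))$ whose first argument is used only through a \<open>\<sigma>\<close>-algebra independent of
  \<open>\<theta>\<close>, the sample may be replaced by an independent copy on a product space. The \<open>\<sigma>\<close>-algebras used
  are generated by the initial iterate and a set $J$ of sample indices, and every sample with
  index outside $J$ is fresh for them (\<open>fresh_sample_outside\<close>). Everything is done for the components
  along the basis vectors.\<close>

section \<open>Orthogonal sums and conditional expectations\<close>

lemma integrable_mult_of_squares:
  fixes f g :: "'w \<Rightarrow> real"
  assumes [measurable]: "f \<in> borel_measurable M" "g \<in> borel_measurable M"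
    and f2: "integrable M (\<lambda>x. (f x)\<^sup>2)" and g2: "integrable M (\<lambda>x. (g x)\<^sup>2)"
  shows "integrable M (\<lambda>x. f x * g x)"
proof (rule Bochner_Integration.integrable_bound)
  show "integrable M (\<lambda>x. (f x)\<^sup>2 + (g x)\<^sup>2)" using f2 g2 by simp
  have "\<bar>a * b\<bar> \<le> a\<^sup>2 + b\<^sup>2" for a b :: real
  proof -
    have "0 \<le> \<bar>a\<bar> * \<bar>b\<bar>" by simp
    with sum_squares_bound[of "\<bar>a\<bar>" "\<bar>b\<bar>"] show ?thesis unfolding abs_mult power2_abs by linarith
  qed
  then show "AE x in M. norm (f x * g x) \<le> norm ((f x)\<^sup>2 + (g x)\<^sup>2)" by simp
qed simp

text \<open>Pythagoras in $L^2$, with the integrability that makes the expansion of the square legitimate.\<close>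

lemma
  fixes Z :: "'i \<Rightarrow> 'w \<Rightarrow> real"
  assumes "finite I" and [measurable]: "\<And>p. p \<in> I \<Longrightarrow> Z p \<in> borel_measurable M"
    and sq: "\<And>p. p \<in> I \<Longrightarrow> integrable M (\<lambda>x. (Z p x)\<^sup>2)"
    and orth: "\<And>p q. p \<in> I \<Longrightarrow> q \<in> I \<Longrightarrow> p \<noteq> q \<Longrightarrow> (\<integral>x. Z p x * Z q x \<partial>M) = 0"
  shows integrable_square_sum_orthogonal:
      "integrable M (\<lambda>x. (\<Sum>p\<in>I. c p * Z p x)\<^sup>2)" (is ?int)
    and integral_square_sum_orthogonal:
      "(\<integral>x. (\<Sum>p\<in>I. c p * Z p x)\<^sup>2 \<partial>M) = (\<Sum>p\<in>I. (c p)\<^sup>2 * (\<integral>x. (Z p x)\<^sup>2 \<partial>M))" (is ?eq)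
proof -
  have expand: "(\<Sum>p\<in>I. c p * Z p x)\<^sup>2 = (\<Sum>p\<in>I. \<Sum>q\<in>I. (c p * c q) * (Z p x * Z q x))" for x
    by (simp add: power2_eq_square sum_product mult_ac)
  have prod: "integrable M (\<lambda>x. (c p * c q) * (Z p x * Z q x))" if "p \<in> I" "q \<in> I" for p q
    using that sq by (intro integrable_mult_right integrable_mult_of_squares) auto
  show ?int unfolding expand by (intro Bochner_Integration.integrable_sum prod)
  have "(\<integral>x. (\<Sum>p\<in>I. c p * Z p x)\<^sup>2 \<partial>M) = (\<Sum>p\<in>I. \<Sum>q\<in>I. (\<integral>x. (c p * c q) * (Z p x * Z q x) \<partial>M))"
  proof -
    have "(\<integral>x. (\<Sum>p\<in>I. c p * Z p x)\<^sup>2 \<partial>M) = (\<Sum>p\<in>I. (\<integral>x. (\<Sum>q\<in>I. (c p * c q) * (Z p x * Z q x)) \<partial>M))"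
      unfolding expand by (intro Bochner_Integration.integral_sum Bochner_Integration.integrable_sum prod)
    also have "\<dots> = (\<Sum>p\<in>I. \<Sum>q\<in>I. (\<integral>x. (c p * c q) * (Z p x * Z q x) \<partial>M))"
      by (intro sum.cong refl Bochner_Integration.integral_sum prod)
    finally show ?thesis .
  qed
  also have "\<dots> = (\<Sum>p\<in>I. \<Sum>q\<in>I. if q = p then (c p)\<^sup>2 * (\<integral>x. (Z p x)\<^sup>2 \<partial>M) else 0)"
    using orth by (intro sum.cong refl) (auto simp: power2_eq_square)
  finally show ?eq using \<open>finite I\<close> by simp
qed

lemma (in sigma_finite_subalgebra) real_cond_exp_linear_combination:
  fixes f g :: "'i \<Rightarrow> 'a \<Rightarrow> real"
  assumes "finite I" and "\<And>p. p \<in> I \<Longrightarrow> integrable M (f p)"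
    and "\<And>p. p \<in> I \<Longrightarrow> AE x in M. real_cond_exp M F (f p) x = g p x"
  shows "AE x in M. real_cond_exp M F (\<lambda>x. \<Sum>p\<in>I. c p * f p x) x = (\<Sum>p\<in>I. c p * g p x)"
  using assms
proof (induction I)
  case empty
  then show ?case using real_cond_exp_F_meas[of "\<lambda>_. 0"] by simp
next
  case (insert p I)
  have "integrable M (\<lambda>x. \<Sum>p\<in>I. c p * f p x)" "integrable M (\<lambda>x. c p * f p x)"
    using insert.prems(1) by auto
  then have "AE x in M. real_cond_exp M F (\<lambda>x. c p * f p x + (\<Sum>p\<in>I. c p * f p x)) x
      = real_cond_exp M F (\<lambda>x. c p * f p x) x + real_cond_exp M F (\<lambda>x. \<Sum>p\<in>I. c p * f p x) x"
    by (intro real_cond_exp_add)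
  moreover have "AE x in M. real_cond_exp M F (\<lambda>x. c p * f p x) x = c p * real_cond_exp M F (f p) x"
    using insert.prems(1) by (intro real_cond_exp_cmult) auto
  moreover have "AE x in M. real_cond_exp M F (f p) x = g p x"
    using insert.prems(2) by simp
  moreover have "AE x in M. real_cond_exp M F (\<lambda>x. \<Sum>p\<in>I. c p * f p x) x = (\<Sum>p\<in>I. c p * g p x)"
    using insert by simp
  ultimately have "AE x in M. real_cond_exp M F (\<lambda>x. c p * f p x + (\<Sum>p\<in>I. c p * f p x)) x
      = c p * g p x + (\<Sum>p\<in>I. c p * g p x)"
    by eventually_elim simp
  then show ?case using insert.hyps by simp
qed

section \<open>Decoupling a sample from independent information\<close>

text \<open>The \<open>\<sigma>\<close>-algebra \<open>F\<close> carries the information against which the sample is fresh. Working with a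
  \<open>\<sigma>\<close>-algebra instead of a random variable generating it lets the iterates enter an integrand
  \<open>h (\<omega>, t)\<close> through \<open>\<omega>\<close> itself, subject only to measurability, without factoring them through the data
  that they are computed from.\<close>

locale fresh_sample = prob_space M for M :: "'w measure" +
  fixes F :: "'w measure" and \<pi> :: "'t measure" and \<theta> :: "'w \<Rightarrow> 't"
  assumes subalg_F: "subalgebra M F"
    and sample_measurable [measurable]: "\<theta> \<in> M \<rightarrow>\<^sub>M \<pi>"
    and sample_law: "distr M \<pi> \<theta> = \<pi>"
    and sample_indep: "indep_set (sets F) (sets (vimage_algebra (space M) \<theta> \<pi>))"
begin

lemma prob_space_law: "prob_space \<pi>"
  using prob_space_distr[OF sample_measurable] by (simp add: sample_law)

lemma pair_sigma_finite_law: "pair_sigma_finite M \<pi>"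
proof -
  interpret law: prob_space \<pi> by (rule prob_space_law)
  show ?thesis by unfold_locales
qed

lemma ident_measurable: "(\<lambda>\<omega>. \<omega>) \<in> M \<rightarrow>\<^sub>M F"
  by (rule measurable_from_subalg[OF subalg_F]) simp

lemma measurable_pair_fine:
  "h \<in> F \<Otimes>\<^sub>M \<pi> \<rightarrow>\<^sub>M N \<Longrightarrow> h \<in> M \<Otimes>\<^sub>M \<pi> \<rightarrow>\<^sub>M N"
proof (rule measurable_compose[of "\<lambda>x. x" "M \<Otimes>\<^sub>M \<pi>" "F \<Otimes>\<^sub>M \<pi>" h N])
  show "(\<lambda>x. x) \<in> M \<Otimes>\<^sub>M \<pi> \<rightarrow>\<^sub>M F \<Otimes>\<^sub>M \<pi>"
  proof (rule measurable_pair)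
    show "fst \<circ> (\<lambda>x. x) \<in> M \<Otimes>\<^sub>M \<pi> \<rightarrow>\<^sub>M F"
      using measurable_compose[OF measurable_fst ident_measurable] by (simp add: comp_def)
  qed (simp add: comp_def)
qed

lemma pair_sample_measurable: "(\<lambda>\<omega>. (\<omega>, \<theta> \<omega>)) \<in> M \<rightarrow>\<^sub>M F \<Otimes>\<^sub>M \<pi>"
  by (rule measurable_Pair[OF ident_measurable sample_measurable])

text \<open>Both sides give a rectangle \<open>A \<times> B\<close> with \<open>A \<in> sets F\<close> the mass \<open>prob A * measure \<pi> B\<close>, the left one
  by independence. On \<open>F \<Otimes>\<^sub>M \<pi>\<close> the pair of the outcome and the sample therefore cannot be told from
  the pair of the outcome and an independent draw from \<open>\<pi>\<close>, although the sample is a function of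
  the outcome.\<close>

lemma joint_law:
  "distr M (F \<Otimes>\<^sub>M \<pi>) (\<lambda>\<omega>. (\<omega>, \<theta> \<omega>)) = distr (M \<Otimes>\<^sub>M \<pi>) (F \<Otimes>\<^sub>M \<pi>) (\<lambda>x. x)"
proof -
  interpret law: prob_space \<pi> by (rule prob_space_law)
  interpret coarse: prob_space "distr M F (\<lambda>\<omega>. \<omega>)" by (rule prob_space_distr) (rule ident_measurable)
  note [measurable] = pair_sample_measurable
  have [measurable]: "(\<lambda>x. x) \<in> M \<Otimes>\<^sub>M \<pi> \<rightarrow>\<^sub>M F \<Otimes>\<^sub>M \<pi>"
    by (rule measurable_pair_fine) simp
  have space_F: "space F = space M" and sets_F: "sets F \<subseteq> sets M"
    using subalg_F by (auto simp: subalgebra_def)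
  have "distr M F (\<lambda>\<omega>. \<omega>) \<Otimes>\<^sub>M \<pi> = distr M (F \<Otimes>\<^sub>M \<pi>) (\<lambda>\<omega>. (\<omega>, \<theta> \<omega>))"
  proof (rule pair_measure_eqI)
    fix A B assume A: "A \<in> sets (distr M F (\<lambda>\<omega>. \<omega>))" and B: "B \<in> sets \<pi>"
    then have A': "A \<in> sets F" "A \<in> sets M" using sets_F by auto
    have B': "\<theta> -` B \<inter> space M \<in> sets (vimage_algebra (space M) \<theta> \<pi>)"
      by (rule in_vimage_algebra[OF B])
    have law_B: "measure \<pi> B = prob (\<theta> -` B \<inter> space M)"
      using measure_distr[OF sample_measurable B] by (simp add: sample_law)
    have A_vim: "(\<lambda>\<omega>. \<omega>) -` A \<inter> space M = A" using sets.sets_into_space[OF A'(2)] by auto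
    have "emeasure (distr M F (\<lambda>\<omega>. \<omega>)) A = prob A"
      using A' by (simp add: emeasure_distr A_vim emeasure_eq_measure)
    moreover have "emeasure \<pi> B = prob (\<theta> -` B \<inter> space M)"
      by (simp add: law.emeasure_eq_measure law_B)
    moreover have "(\<lambda>\<omega>. (\<omega>, \<theta> \<omega>)) -` (A \<times> B) \<inter> space M = A \<inter> (\<theta> -` B \<inter> space M)" by auto
    then have "emeasure (distr M (F \<Otimes>\<^sub>M \<pi>) (\<lambda>\<omega>. (\<omega>, \<theta> \<omega>))) (A \<times> B)
        = prob (A \<inter> (\<theta> -` B \<inter> space M))"
      using A' B by (subst emeasure_distr) (auto simp: emeasure_eq_measure)
    ultimately show "emeasure (distr M F (\<lambda>\<omega>. \<omega>)) A * emeasure \<pi> B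
        = emeasure (distr M (F \<Otimes>\<^sub>M \<pi>) (\<lambda>\<omega>. (\<omega>, \<theta> \<omega>))) (A \<times> B)"
      using indep_setD[OF sample_indep A'(1) B'] by (simp add: ennreal_mult'')
  qed (auto intro!: coarse.sigma_finite_measure_axioms law.sigma_finite_measure_axioms sets_pair_measure_cong)
  moreover have "distr M F (\<lambda>\<omega>. \<omega>) \<Otimes>\<^sub>M \<pi> = distr (M \<Otimes>\<^sub>M \<pi>) (F \<Otimes>\<^sub>M \<pi>) (\<lambda>x. x)"
  proof (rule pair_measure_eqI)
    fix A B assume A: "A \<in> sets (distr M F (\<lambda>\<omega>. \<omega>))" and B: "B \<in> sets \<pi>"
    then have A': "A \<in> sets F" "A \<in> sets M" using sets_F by auto
    have vim: "(\<lambda>x. x) -` (A \<times> B) \<inter> space (M \<Otimes>\<^sub>M \<pi>) = A \<times> B" 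
      "(\<lambda>\<omega>. \<omega>) -` A \<inter> space M = A"
      using sets.sets_into_space[OF A'(2)] sets.sets_into_space[OF B] by (auto simp: space_pair_measure)
    show "emeasure (distr M F (\<lambda>\<omega>. \<omega>)) A * emeasure \<pi> B
        = emeasure (distr (M \<Otimes>\<^sub>M \<pi>) (F \<Otimes>\<^sub>M \<pi>) (\<lambda>x. x)) (A \<times> B)"
      using A' B by (simp add: emeasure_distr vim law.emeasure_pair_measure_Times)
  qed (auto intro!: coarse.sigma_finite_measure_axioms law.sigma_finite_measure_axioms sets_pair_measure_cong)
  ultimately show ?thesis by simp
qed

context
  fixes h :: "'w \<times> 't \<Rightarrow> real"
  assumes h [measurable]: "h \<in> borel_measurable (F \<Otimes>\<^sub>M \<pi>)"
begin

lemma integrable_sample_iff: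
  "integrable M (\<lambda>\<omega>. h (\<omega>, \<theta> \<omega>)) \<longleftrightarrow> integrable (M \<Otimes>\<^sub>M \<pi>) h"
proof -
  note [measurable] = pair_sample_measurable
  have [measurable]: "(\<lambda>x. x) \<in> M \<Otimes>\<^sub>M \<pi> \<rightarrow>\<^sub>M F \<Otimes>\<^sub>M \<pi>"
    by (rule measurable_pair_fine) simp
  have "integrable M (\<lambda>\<omega>. h (\<omega>, \<theta> \<omega>)) \<longleftrightarrow> integrable (distr M (F \<Otimes>\<^sub>M \<pi>) (\<lambda>\<omega>. (\<omega>, \<theta> \<omega>))) h"
    by (subst integrable_distr_eq) auto
  also have "\<dots> \<longleftrightarrow> integrable (M \<Otimes>\<^sub>M \<pi>) h"
    unfolding joint_law by (subst integrable_distr_eq) auto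
  finally show ?thesis .
qed

lemma integral_sample: "(\<integral>\<omega>. h (\<omega>, \<theta> \<omega>) \<partial>M) = (\<integral>x. h x \<partial>(M \<Otimes>\<^sub>M \<pi>))"
proof -
  note [measurable] = pair_sample_measurable
  have [measurable]: "(\<lambda>x. x) \<in> M \<Otimes>\<^sub>M \<pi> \<rightarrow>\<^sub>M F \<Otimes>\<^sub>M \<pi>"
    by (rule measurable_pair_fine) simp
  have "(\<integral>\<omega>. h (\<omega>, \<theta> \<omega>) \<partial>M) = (\<integral>x. h x \<partial>distr M (F \<Otimes>\<^sub>M \<pi>) (\<lambda>\<omega>. (\<omega>, \<theta> \<omega>)))"
    by (subst integral_distr) auto
  also have "\<dots> = (\<integral>x. h x \<partial>(M \<Otimes>\<^sub>M \<pi>))"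
    unfolding joint_law by (subst integral_distr) auto
  finally show ?thesis .
qed

lemma integral_sample_iterated:
  assumes "integrable (M \<Otimes>\<^sub>M \<pi>) h"
  shows "(\<integral>\<omega>. h (\<omega>, \<theta> \<omega>) \<partial>M) = (\<integral>\<omega>. (\<integral>t. h (\<omega>, t) \<partial>\<pi>) \<partial>M)"
  using pair_sigma_finite.integral_fst'[OF pair_sigma_finite_law assms] by (simp add: integral_sample)

lemma mean_measurable [measurable]: "(\<lambda>\<omega>. \<integral>t. h (\<omega>, t) \<partial>\<pi>) \<in> borel_measurable F"
proof -
  interpret law: prob_space \<pi> by (rule prob_space_law)
  show ?thesis by (rule law.borel_measurable_lebesgue_integral) simp
qed

end

text \<open>Multiplying \<open>h\<close> with the indicator of an event of \<open>F\<close> keeps it \<open>F \<Otimes>\<^sub>M \<pi>\<close>-measurable, so decoupling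
  the sample verifies the defining property of the conditional expectation.\<close>

lemma cond_exp_sample:
  fixes h :: "'w \<times> 't \<Rightarrow> real"
  assumes h [measurable]: "h \<in> borel_measurable (F \<Otimes>\<^sub>M \<pi>)" and int: "integrable (M \<Otimes>\<^sub>M \<pi>) h"
  shows "AE \<omega> in M. real_cond_exp M F (\<lambda>\<omega>. h (\<omega>, \<theta> \<omega>)) \<omega> = (\<integral>t. h (\<omega>, t) \<partial>\<pi>)"
proof -
  interpret finite_measure_subalgebra M F
    by unfold_locales (rule subalg_F)
  show ?thesis
  proof (rule real_cond_exp_charact)
    show "integrable M (\<lambda>\<omega>. h (\<omega>, \<theta> \<omega>))" using int by (simp add: integrable_sample_iff)
    show "integrable M (\<lambda>\<omega>. \<integral>t. h (\<omega>, t) \<partial>\<pi>)"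
      by (rule pair_sigma_finite.integrable_fst'[OF pair_sigma_finite_law int])
    show "(\<lambda>\<omega>. \<integral>t. h (\<omega>, t) \<partial>\<pi>) \<in> borel_measurable F" by simp
    fix A assume A [measurable]: "A \<in> sets F"
    then have A': "A \<in> sets M" using subalg_F by (auto simp: subalgebra_def)
    let ?g = "\<lambda>x. indicator A (fst x) * h x"
    have meas: "?g \<in> borel_measurable (F \<Otimes>\<^sub>M \<pi>)" by measurable
    have "integrable (M \<Otimes>\<^sub>M \<pi>) (\<lambda>x. indicator (A \<times> space \<pi>) x *\<^sub>R h x)"
      using A' by (intro integrable_mult_indicator int) auto
    also have "?this \<longleftrightarrow> integrable (M \<Otimes>\<^sub>M \<pi>) ?g"
      by (intro Bochner_Integration.integrable_cong refl)
        (auto simp: space_pair_measure split: split_indicator)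
    finally have "integrable (M \<Otimes>\<^sub>M \<pi>) ?g" .
    from integral_sample_iterated[OF meas this]
    show "(\<integral>\<omega>\<in>A. h (\<omega>, \<theta> \<omega>) \<partial>M) = (\<integral>\<omega>\<in>A. (\<integral>t. h (\<omega>, t) \<partial>\<pi>) \<partial>M)"
      by (simp add: set_lebesgue_integral_def)
  qed
qed

text \<open>This is how two different samples are shown to be uncorrelated: \<open>Y\<close> is the term that is known given
  \<open>F\<close>, and the fresh sample averages \<open>h\<close> to zero.\<close>

lemma integral_sample_centred:
  fixes h :: "'w \<times> 't \<Rightarrow> real" and Y :: "'w \<Rightarrow> real"
  assumes h [measurable]: "h \<in> borel_measurable (F \<Otimes>\<^sub>M \<pi>)" and Y [measurable]: "Y \<in> borel_measurable F"
    and h2: "integrable M (\<lambda>\<omega>. (h (\<omega>, \<theta> \<omega>))\<^sup>2)" and Y2: "integrable M (\<lambda>\<omega>. (Y \<omega>)\<^sup>2)"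
    and centred: "\<And>\<omega>. \<omega> \<in> space M \<Longrightarrow> (\<integral>t. h (\<omega>, t) \<partial>\<pi>) = 0"
  shows "(\<integral>\<omega>. Y \<omega> * h (\<omega>, \<theta> \<omega>) \<partial>M) = 0"
proof -
  have [measurable]: "Y \<in> borel_measurable M" by (rule measurable_from_subalg[OF subalg_F Y])
  have [measurable]: "(\<lambda>\<omega>. h (\<omega>, \<theta> \<omega>)) \<in> borel_measurable M"
    by (rule measurable_compose[OF pair_sample_measurable h])
  have "integrable M (\<lambda>\<omega>. Y \<omega> * h (\<omega>, \<theta> \<omega>))"
    by (rule integrable_mult_of_squares[OF _ _ Y2 h2]) simp_all
  then have "integrable (M \<Otimes>\<^sub>M \<pi>) (\<lambda>x. Y (fst x) * h x)"
    using integrable_sample_iff[of "\<lambda>x. Y (fst x) * h x"] by simp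
  from integral_sample_iterated[OF _ this]
  have "(\<integral>\<omega>. Y \<omega> * h (\<omega>, \<theta> \<omega>) \<partial>M) = (\<integral>\<omega>. Y \<omega> * (\<integral>t. h (\<omega>, t) \<partial>\<pi>) \<partial>M)" by simp
  also have "\<dots> = (\<integral>\<omega>. 0 \<partial>M)" using centred by (intro Bochner_Integration.integral_cong) auto
  finally show ?thesis by simp
qed

end

section \<open>Levels, predecessors and sample indices\<close>

text \<open>Adding a new maximum \<open>b\<close> to \<open>A\<close> adds the summand \<open>h b - h (Max A)\<close> and leaves the predecessors of
  the old elements unchanged, so the sum telescopes.\<close>

lemma sum_diff_predecessor:
  fixes h :: "nat \<Rightarrow> 'a::real_vector"
  assumes "finite A" "A \<noteq> {}"
  shows "(\<Sum>l\<in>A. if l > Min A then h l - h (Max {l'\<in>A. l' < l}) else h l) = h (Max A)"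
  using assms
proof (induction A rule: finite_linorder_max_induct)
  case (insert b A)
  show ?case
  proof (cases "A = {}")
    case False
    have Max: "Max (insert b A) = b"
      using insert.hyps by (intro Max_eqI) (auto intro: less_imp_le)
    have Min: "Min (insert b A) = Min A"
      using insert.hyps False by (simp add: min_absorb2 less_imp_le)
    have "b > Min A" using insert.hyps False by auto
    moreover have "{l' \<in> insert b A. l' < b} = A" using insert.hyps by auto
    moreover have "(\<Sum>l\<in>A. if l > Min A then h l - h (Max {l'\<in>insert b A. l' < l}) else h l)
        = (\<Sum>l\<in>A. if l > Min A then h l - h (Max {l'\<in>A. l' < l}) else h l)"
    proof (rule sum.cong[OF refl])
      fix l assume "l \<in> A"
      then have "{l' \<in> insert b A. l' < l} = {l' \<in> A. l' < l}" using insert.hyps by auto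
      then show "(if l > Min A then h l - h (Max {l'\<in>insert b A. l' < l}) else h l)
          = (if l > Min A then h l - h (Max {l'\<in>A. l' < l}) else h l)" by simp
    qed
    moreover have "b \<notin> A" using insert.hyps by auto
    ultimately show ?thesis
      using insert.hyps insert.IH False unfolding Max Min by (subst sum.insert) auto
  qed simp
qed simp

context mice_setting
begin

lemma self_in_L: "k \<in> L k"
  using L_0 L_self[of k] by (cases k) auto

lemma L_pred: "l \<in> L (Suc k) \<Longrightarrow> l \<noteq> Suc k \<Longrightarrow> l \<in> L k"
  using L_subset[of "Suc k"] by auto

lemma L_le: "l \<in> L k \<Longrightarrow> l \<le> k"
proof (induction k)
  case (Suc k)
  then show ?case using L_pred[of l k] by (cases "l = Suc k") auto
qed (simp add: L_0)

lemma finite_L: "finite (L k)"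
  by (rule finite_subset[of _ "{..k}"]) (auto dest: L_le)

lemma Max_L: "Max (L k) = k"
  using self_in_L L_le finite_L by (intro Max_eqI) auto

text \<open>A level can enter an index set only at its own iteration, so once dropped it never returns. This is
  what makes the samples of a current level that were drawn earlier an initial segment of its sequence.\<close>

lemma L_persistent: "l \<in> L k \<Longrightarrow> l \<le> j \<Longrightarrow> j \<le> k \<Longrightarrow> l \<in> L j"
proof (induction k)
  case (Suc k)
  then show ?case using L_pred[of l k] by (cases "j = Suc k") auto
qed simp

lemma N_mono_persistent: "l \<in> L k \<Longrightarrow> l \<le> i \<Longrightarrow> i \<le> k \<Longrightarrow> N l i \<le> N l k"
proof (induction k)
  case (Suc k)
  show ?case
  proof (cases "i = Suc k")
    case False
    then have "l \<in> L k" "i \<le> k" using Suc.prems L_pred[of l k] by auto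
    then show ?thesis using Suc N_mono[of "Suc k" l] by simp
  qed simp
qed simp

lemma sum_level_diff: "(\<Sum>l\<in>L k. level_diff L k l h) = h k"
proof -
  have "L k \<noteq> {}" using self_in_L[of k] by blast
  from sum_diff_predecessor[OF finite_L this, of h] show ?thesis
    unfolding level_diff_def prev_level_def Max_L .
qed

lemma prev_level_less:
  assumes "l \<in> L k" "l > Min (L k)"
  shows "prev_level L k l < l" 
proof -
  have "Min (L k) \<in> {l' \<in> L k. l' < l}"
    using assms finite_L[of k] by (auto intro: Min_in)
  moreover have "finite {l' \<in> L k. l' < l}" using finite_L[of k] by simp
  ultimately have "Max {l' \<in> L k. l' < l} \<in> {l' \<in> L k. l' < l}" by (intro Max_in) auto
  then show ?thesis by (simp add: prev_level_def)
qed

lemma drawn_at_exhausts: "l \<in> L k \<Longrightarrow> \<alpha> < N l k \<Longrightarrow> \<exists>j\<le>k. (l, \<alpha>) \<in> drawn_at L N j"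
proof (induction k)
  case 0
  then show ?case by (auto simp: drawn_at_def)
next
  case (Suc k)
  show ?case
  proof (cases "l \<in> L k \<and> \<alpha> < N l k")
    case True
    with Suc.IH obtain j where "j \<le> k" "(l, \<alpha>) \<in> drawn_at L N j" by blast
    then show ?thesis by (intro exI[of _ j]) auto
  next
    case False
    then have "(l, \<alpha>) \<in> drawn_at L N (Suc k)" using Suc.prems by (auto simp: drawn_at_def)
    then show ?thesis by blast
  qed
qed

lemma drawn_atD: "(l, \<alpha>) \<in> drawn_at L N j \<Longrightarrow> l \<in> L j \<and> \<alpha> < N l j"
  by (auto simp: drawn_at_def split: if_splits)

text \<open>Level \<open>l\<close> is sampled for the first time at iteration \<open>l\<close>; in particular the iterate \<open>xi l\<close>, computed
  before that, is independent of all samples of level \<open>l\<close>.\<close>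

lemma drawn_before_level: "p \<in> drawn_before L N k \<Longrightarrow> fst p < k"
  by (cases p) (auto simp: drawn_before_def dest!: drawn_atD dest: L_le)

lemma drawn_before_mono: "j \<le> k \<Longrightarrow> drawn_before L N j \<subseteq> drawn_before L N k"
  by (auto simp: drawn_before_def intro: less_le_trans)

lemma drawn_before_Suc_iff:
  assumes "l \<in> L (Suc k)"
  shows "(l, \<alpha>) \<in> drawn_before L N (Suc k) \<longleftrightarrow> l \<in> L k \<and> \<alpha> < N l k"
proof
  assume "(l, \<alpha>) \<in> drawn_before L N (Suc k)"
  then obtain j where "j < Suc k" "(l, \<alpha>) \<in> drawn_at L N j"
    unfolding drawn_before_def by blast
  then have j: "j \<le> k" "l \<in> L j" "\<alpha> < N l j" by (auto dest: drawn_atD)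
  then have l: "l \<in> L k" using L_persistent[OF assms, of k] L_le[of l j] by simp
  have "N l j \<le> N l k" using N_mono_persistent[OF l, of j] j L_le[of l j] by simp
  with j l show "l \<in> L k \<and> \<alpha> < N l k" by simp
next
  assume "l \<in> L k \<and> \<alpha> < N l k"
  then show "(l, \<alpha>) \<in> drawn_before L N (Suc k)"
    using drawn_at_exhausts[of l k \<alpha>] by (auto simp: drawn_before_def less_Suc_eq_le)
qed

section \<open>Information generated by sets of samples\<close>

text \<open>The information in the initial iterate and the samples with indices in \<open>J\<close>. It generalizes \<open>history\<close>
  from the sets \<open>drawn_before\<close> to arbitrary \<open>J\<close>: the orthogonality argument conditions on sets of
  samples that are not the past of any iteration.\<close>

definition sample_info :: "(nat \<times> nat) set \<Rightarrow> 'w measure" where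
  "sample_info J = vimage_algebra (space M)
     (\<lambda>\<omega>. (xi 0 \<omega>, \<lambda>p\<in>J. \<theta> (fst p) (snd p) \<omega>)) (borel \<Otimes>\<^sub>M Pi\<^sub>M J (\<lambda>_. \<pi>))"

lemma history_eq_sample_info: "history M L N \<pi> \<theta> xi k = sample_info (drawn_before L N k)"
  by (simp add: history_def sample_info_def past_data_def[abs_def] past_space_def)

lemma space_sample_info [simp]: "space (sample_info J) = space M"
  by (simp add: sample_info_def)

lemma theta_measurable: "\<theta> l \<alpha> \<in> M \<rightarrow>\<^sub>M \<pi>"
  using samples_indep[of l] by (auto simp: indep_vars_def2)

lemma theta_space: "\<omega> \<in> space M \<Longrightarrow> \<theta> l \<alpha> \<omega> \<in> space \<pi>"
  using theta_measurable by (rule measurable_space)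

lemma data_measurable_sample_info:
  "(\<lambda>\<omega>. (xi 0 \<omega>, \<lambda>p\<in>J. \<theta> (fst p) (snd p) \<omega>)) \<in> sample_info J \<rightarrow>\<^sub>M borel \<Otimes>\<^sub>M Pi\<^sub>M J (\<lambda>_. \<pi>)"
  unfolding sample_info_def
  by (rule measurable_vimage_algebra1) (auto simp: space_pair_measure space_PiM PiE_iff theta_space)

lemma sample_info_xi_0: "xi 0 \<in> borel_measurable (sample_info J)"
  using measurable_compose[OF data_measurable_sample_info measurable_fst] by simp

lemma sample_info_theta:
  assumes "(l, \<alpha>) \<in> J" shows "\<theta> l \<alpha> \<in> sample_info J \<rightarrow>\<^sub>M \<pi>"
  using measurable_compose[OF measurable_compose[OF data_measurable_sample_info measurable_snd]
      measurable_component_singleton[OF assms]] assms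
  by simp

lemma data_measurable:
  assumes "xi 0 \<in> borel_measurable G" "\<And>l \<alpha>. (l, \<alpha>) \<in> J \<Longrightarrow> \<theta> l \<alpha> \<in> G \<rightarrow>\<^sub>M \<pi>"
  shows "(\<lambda>\<omega>. (xi 0 \<omega>, \<lambda>p\<in>J. \<theta> (fst p) (snd p) \<omega>)) \<in> G \<rightarrow>\<^sub>M borel \<Otimes>\<^sub>M Pi\<^sub>M J (\<lambda>_. \<pi>)"
  using assms by (intro measurable_Pair measurable_restrict) auto

lemma sample_info_least:
  assumes "space G = space M" "xi 0 \<in> borel_measurable G"
    "\<And>l \<alpha>. (l, \<alpha>) \<in> J \<Longrightarrow> \<theta> l \<alpha> \<in> G \<rightarrow>\<^sub>M \<pi>"
  shows "sets (sample_info J) \<subseteq> sets G"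
  unfolding sample_info_def using assms by (intro sets_image_in_sets data_measurable)

lemma subalgebra_sample_info: "subalgebra M (sample_info J)"
  using sample_info_least[of M J] xi_0_measurable theta_measurable by (auto simp: subalgebra_def)

lemma xi_adapted:
  assumes "drawn_before L N j \<subseteq> J"
  shows "xi j \<in> borel_measurable (sample_info J)"
proof (cases j)
  case 0
  then show ?thesis by (simp add: sample_info_xi_0)
next
  case (Suc i)
  obtain g where g: "g \<in> borel_measurable (past_space L N \<pi> j)"
    and xi: "\<And>\<omega>. \<omega> \<in> space M \<Longrightarrow> xi j \<omega> = g (past_data L N \<theta> xi j \<omega>)"
    using xi_Suc[of i] Suc by auto
  have "past_data L N \<theta> xi j \<in> sample_info J \<rightarrow>\<^sub>M past_space L N \<pi> j"
    unfolding past_data_def[abs_def] past_space_def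
    using assms by (intro data_measurable sample_info_xi_0 sample_info_theta) auto
  from measurable_compose[OF this g] show ?thesis
    using xi by (subst measurable_cong[where g = "\<lambda>\<omega>. g (past_data L N \<theta> xi j \<omega>)"]) auto
qed

text \<open>The independent sources of randomness, one for each sample (\<open>Some\<close>) and one for the initial iterate (\<open>None\<close>).\<close>

definition source_events :: "(nat \<times> nat) option \<Rightarrow> 'w set set" where
  "source_events = case_option (sets (vimage_algebra (space M) (xi 0) borel))
     (\<lambda>(l, \<alpha>). sets (vimage_algebra (space M) (\<theta> l \<alpha>) \<pi>))"

text \<open>Independence is assumed in two stages, between the sample sequences of different levels and between
  the members of each sequence. For finitely many sources, an intersection of events is grouped by
  level, and the two product formulas are applied one after the other.\<close>

lemma sources_indep: "indep_sets source_events UNIV"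
proof (rule indep_setsI)
  have vim_theta: "sets (vimage_algebra (space M) (\<theta> l \<alpha>) \<pi>) = {\<theta> l \<alpha> -` A \<inter> space M | A. A \<in> sets \<pi>}" for l \<alpha>
    by (rule sets_vimage_algebra2) (auto simp: theta_space)
  show events: "source_events i \<subseteq> events" for i
    using sets_image_in_sets[OF refl xi_0_measurable] sets_image_in_sets[OF refl theta_measurable]
    by (auto simp: source_events_def split: option.splits)
  let ?level = "case_option (sets (vimage_algebra (space M) (xi 0) borel))
    (\<lambda>l. sets (vimage_algebra (space M) (\<lambda>\<omega> \<alpha>. \<theta> l \<alpha> \<omega>) (Pi\<^sub>M UNIV (\<lambda>_. \<pi>))))"
  fix A :: "(nat \<times> nat) option \<Rightarrow> 'w set" and K
  assume K: "K \<noteq> {}" "finite K" and A: "\<forall>j\<in>K. A j \<in> source_events j"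
  \<comment> \<open>Filling up with the sure event turns \<open>K\<close> into a full rectangle of levels and sample numbers, so
    that the grouping by level becomes an iterated product. The element 0 in \<open>Y\<close> avoids empty
    intersections within a level.\<close>
  define A' where "A' j = (if j \<in> K then A j else space M)" for j
  have space_in: "space M \<in> source_events j" for j
    using sets.top[of "vimage_algebra (space M) (xi 0) borel"]
      sets.top[of "vimage_algebra (space M) (\<theta> l \<alpha>) \<pi>" for l \<alpha>]
    by (auto simp: source_events_def split: option.splits)
  have A': "A' j \<in> source_events j" for j using A space_in by (auto simp: A'_def)
  define P where "P = {p. Some p \<in> K}"
  have "finite P" unfolding P_def using finite_vimageI[OF K(2), of Some] by (simp add: vimage_def)
  define X where "X = fst ` P"
  define Y where "Y = insert 0 (snd ` P)"
  have XY: "finite X" "finite Y" "Y \<noteq> {}" using \<open>finite P\<close> by (auto simp: X_def Y_def)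
  define K' where "K' = insert None (Some ` (X \<times> Y))"
  have K': "K \<subseteq> K'" "finite K'" 
  proof -
    show "K \<subseteq> K'"
    proof
      fix j assume "j \<in> K"
      then show "j \<in> K'" 
        by (cases j) (force simp: K'_def X_def Y_def P_def image_iff)+
    qed
  qed (use XY in \<open>simp add: K'_def\<close>)
  define B where "B j = (case j of None \<Rightarrow> A' None | Some l \<Rightarrow> \<Inter>\<alpha>\<in>Y. A' (Some (l, \<alpha>)))" for j
  have B: "B j \<in> ?level j" for j
  proof (cases j)
    case None
    then show ?thesis using A'[of None] by (simp add: B_def source_events_def)
  next
    case (Some l)
    let ?G = "vimage_algebra (space M) (\<lambda>\<omega> \<alpha>. \<theta> l \<alpha> \<omega>) (Pi\<^sub>M UNIV (\<lambda>_. \<pi>))"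
    have "(\<lambda>\<omega> \<alpha>. \<theta> l \<alpha> \<omega>) \<in> ?G \<rightarrow>\<^sub>M Pi\<^sub>M UNIV (\<lambda>_. \<pi>)"
      by (rule measurable_vimage_algebra1) (auto simp: space_PiM theta_space)
    from measurable_compose[OF this measurable_component_singleton[OF UNIV_I]]
    have "\<theta> l \<alpha> \<in> ?G \<rightarrow>\<^sub>M \<pi>" for \<alpha> .
    then have "sets (vimage_algebra (space M) (\<theta> l \<alpha>) \<pi>) \<subseteq> sets ?G" for \<alpha>
      by (intro sets_image_in_sets) auto
    then have "A' (Some (l, \<alpha>)) \<in> sets ?G" for \<alpha>
      using A'[of "Some (l, \<alpha>)"] by (auto simp: source_events_def)
    then show ?thesis using XY Some by (auto simp: B_def intro!: sets.finite_INT)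
  qed
  have "prob (\<Inter>j\<in>K. A j) = prob (\<Inter>j\<in>K'. A' j)"
  proof -
    have "(\<Inter>j\<in>K'. A' j) = (\<Inter>j\<in>K. A' j)"
    proof
      show "(\<Inter>j\<in>K. A' j) \<subseteq> (\<Inter>j\<in>K'. A' j)"
      proof (intro INT_greatest)
        fix j assume "j \<in> K'"
        obtain j0 where j0: "j0 \<in> K" using K by auto
        have "A' j0 \<subseteq> space M" using A'[of j0] events[of j0] sets.sets_into_space by blast
        then show "(\<Inter>j\<in>K. A' j) \<subseteq> A' j"
          using j0 by (cases "j \<in> K") (auto simp: A'_def)
      qed
    qed (use K' in auto)
    then show ?thesis by (simp add: A'_def)
  qed
  also have "(\<Inter>j\<in>K'. A' j) = (\<Inter>j\<in>insert None (Some ` X). B j)"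
    by (auto simp: K'_def B_def)
  also have "prob \<dots> = (\<Prod>j\<in>insert None (Some ` X). prob (B j))"
    using B XY by (intro indep_setsD[OF levels_indep]) auto
  also have "\<dots> = prob (A' None) * (\<Prod>l\<in>X. prob (B (Some l)))"
    using XY by (simp add: prod.reindex B_def)
  also have "\<dots> = prob (A' None) * (\<Prod>l\<in>X. \<Prod>\<alpha>\<in>Y. prob (A' (Some (l, \<alpha>))))"
  proof -
    have "prob (B (Some l)) = (\<Prod>\<alpha>\<in>Y. prob (A' (Some (l, \<alpha>))))" for l
    proof -
      have "indep_sets (\<lambda>\<alpha>. sets (vimage_algebra (space M) (\<theta> l \<alpha>) \<pi>)) UNIV"
        using samples_indep[of l] by (simp add: indep_vars_def2 vim_theta)
      from indep_setsD[OF this, of Y "\<lambda>\<alpha>. A' (Some (l, \<alpha>))"]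
      show ?thesis using XY A'[of "Some (l, \<alpha>)" for \<alpha>] by (simp add: B_def source_events_def)
    qed
    then show ?thesis by simp
  qed
  also have "\<dots> = (\<Prod>j\<in>K'. prob (A' j))"
    using XY by (simp add: K'_def prod.reindex prod.cartesian_product image_iff case_prod_unfold)
  also have "\<dots> = (\<Prod>j\<in>K. prob (A j))"
    using K' by (intro prod.mono_neutral_cong_right) (auto simp: A'_def prob_space)
  finally show "prob (\<Inter>j\<in>K. A j) = (\<Prod>j\<in>K. prob (A j))" .
qed

text \<open>Disjoint groups of independent sources generate independent \<open>\<sigma>\<close>-algebras; here the groups are the
  initial iterate with the samples in \<open>J\<close>, and the single sample \<open>(l, \<alpha>)\<close>.\<close>

lemma fresh_sample_outside:
  assumes "(l, \<alpha>) \<notin> J"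
  shows "fresh_sample M (sample_info J) \<pi> (\<theta> l \<alpha>)"
proof
  show "subalgebra M (sample_info J)" by (rule subalgebra_sample_info)
  show "random_variable \<pi> (\<theta> l \<alpha>)" by (rule theta_measurable)
  show "distr M \<pi> (\<theta> l \<alpha>) = \<pi>" by (rule samples_distr)
  define I where "I b = (if b then insert None (Some ` J) else {Some (l, \<alpha>)})" for b
  let ?S = "\<lambda>b. sigma_sets (space M) (\<Union>i\<in>I b. source_events i)"
  have Int_stable: "Int_stable (source_events i)" for i
    by (auto simp: source_events_def Int_stable_def split: option.splits)
  have sub: "source_events i \<subseteq> Pow (space M)" for i
    using sets.space_closed[of "vimage_algebra (space M) (xi 0) borel"]
      sets.space_closed[of "vimage_algebra (space M) (\<theta> l \<alpha>) \<pi>" for l \<alpha>]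
    by (auto simp: source_events_def split: option.splits)
  have "indep_sets ?S UNIV"
  proof (rule indep_sets_collect_sigma)
    show "indep_sets source_events (\<Union>b. I b)"
      by (rule indep_sets_mono_index[OF _ sources_indep]) simp
    show "disjoint_family_on I UNIV"
      using assms by (auto simp: disjoint_family_on_def I_def)
  qed (rule Int_stable)
  then show "indep_set (sets (sample_info J)) (sets (vimage_algebra (space M) (\<theta> l \<alpha>) \<pi>))"
    unfolding indep_set_def
  proof (rule indep_sets_mono_sets)
    let ?G = "sigma (space M) (\<Union>i\<in>I True. source_events i)"
    have sets_G: "sets ?G = ?S True" by (rule sets_measure_of) (use sub in auto)
    have gen: "f \<in> ?G \<rightarrow>\<^sub>M K" if "i \<in> I True" "f \<in> space M \<rightarrow> space K"
        "source_events i = sets (vimage_algebra (space M) f K)" for f :: "'w \<Rightarrow> 'c" and K i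
    proof (rule measurableI)
      fix A assume "A \<in> sets K"
      then have "f -` A \<inter> space M \<in> source_events i" using that by (simp add: in_vimage_algebra)
      then show "f -` A \<inter> space ?G \<in> sets ?G" using that(1) unfolding sets_G space_measure_of_conv by (auto intro: sigma_sets.Basic)
    qed (use that in \<open>auto simp: space_measure_of_conv\<close>)
    have True: "sets (sample_info J) \<subseteq> ?S True"
      unfolding sets_G[symmetric]
    proof (rule sample_info_least)
      show "xi 0 \<in> borel_measurable ?G"
        by (rule gen[of None]) (auto simp: I_def source_events_def)
      show "\<theta> l' \<alpha>' \<in> ?G \<rightarrow>\<^sub>M \<pi>" if "(l', \<alpha>') \<in> J" for l' \<alpha>'
        using that by (intro gen[of "Some (l', \<alpha>')"]) (auto simp: I_def source_events_def theta_space)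
    qed (simp add: space_measure_of_conv)
    have False: "sets (vimage_algebra (space M) (\<theta> l \<alpha>) \<pi>) \<subseteq> ?S False"
      by (auto simp: I_def source_events_def intro: sigma_sets.Basic)
    show "case_bool (sets (sample_info J)) (sets (vimage_algebra (space M) (\<theta> l \<alpha>) \<pi>)) b \<subseteq> ?S b" for b
      using True False by (cases b) auto
  qed
qed

end

section \<open>Regularity of the gradient differences\<close>

lemma gradient_component_limit:
  assumes "GDERIV h x :> D"
  shows "(\<lambda>n. (h (x + inverse (real (Suc n)) *\<^sub>R i) - h x) / inverse (real (Suc n))) \<longlonglongrightarrow> D \<bullet> i"
proof -
  have "((\<lambda>s. h (x + s *\<^sub>R i)) has_derivative (\<lambda>s. (s *\<^sub>R i) \<bullet> D)) (at 0)"
  proof (rule has_derivative_compose[of "\<lambda>s. x + s *\<^sub>R i" "\<lambda>s. s *\<^sub>R i" 0 UNIV h "\<lambda>v. v \<bullet> D"])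
    show "((\<lambda>s. x + s *\<^sub>R i) has_derivative (\<lambda>s. s *\<^sub>R i)) (at 0)"
      by (auto intro!: derivative_eq_intros)
  qed (use assms in \<open>simp add: gderiv_def\<close>)
  then have "DERIV (\<lambda>s. h (x + s *\<^sub>R i)) 0 :> (i \<bullet> D)"
    unfolding has_field_derivative_def by (rule has_derivative_eq_rhs) (simp add: fun_eq_iff mult.commute)
  then have lim: "(\<lambda>s. (h (x + s *\<^sub>R i) - h x) / s) \<midarrow>0\<rightarrow> D \<bullet> i"
    by (simp add: DERIV_def inner_commute)
  have "filterlim (\<lambda>n. inverse (real (Suc n))) (at 0) sequentially"
    by (intro filterlim_atI LIMSEQ_inverse_real_of_nat) auto
  from filterlim_compose[OF lim this] show ?thesis .
qed

context mice_setting
begin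

text \<open>Joint measurability of the gradient is inherited from \<open>f\<close>, the components being pointwise limits of
  difference quotients.\<close>

lemma gradf_measurable: "(\<lambda>x. gradf (fst x) (snd x)) \<in> borel_measurable (borel \<Otimes>\<^sub>M \<pi>)"
proof (subst borel_measurable_euclidean_space, intro ballI)
  fix i :: 'a assume "i \<in> Basis"
  let ?q = "\<lambda>n x. (f (fst x + inverse (real (Suc n)) *\<^sub>R i) (snd x) - f (fst x) (snd x)) / inverse (real (Suc n))"
  show "(\<lambda>x. gradf (fst x) (snd x) \<bullet> i) \<in> borel_measurable (borel \<Otimes>\<^sub>M \<pi>)"
  proof (rule borel_measurable_LIMSEQ_real)
    show "(\<lambda>n. ?q n x) \<longlonglongrightarrow> gradf (fst x) (snd x) \<bullet> i" if "x \<in> space (borel \<Otimes>\<^sub>M \<pi>)" for x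
      using that gradf[of "snd x" "fst x"] by (intro gradient_component_limit) (auto simp: space_pair_measure)
    fix n
    have shift: "(\<lambda>x. f (fst x + c) (snd x)) \<in> borel_measurable (borel \<Otimes>\<^sub>M \<pi>)" for c
    proof -
      have "(\<lambda>x. (fst x + c, snd x)) \<in> borel \<Otimes>\<^sub>M \<pi> \<rightarrow>\<^sub>M borel \<Otimes>\<^sub>M \<pi>" by measurable
      from measurable_compose[OF this f_measurable] show ?thesis by (simp add: case_prod_beta)
    qed
    show "?q n \<in> borel_measurable (borel \<Otimes>\<^sub>M \<pi>)"
      using shift[of "inverse (real (Suc n)) *\<^sub>R i"] shift[of 0] by simp
  qed
qed

lemma gradf_adapted:
  assumes "drawn_before L N j \<subseteq> J"
  shows "(\<lambda>x. gradf (xi j (fst x)) (snd x)) \<in> borel_measurable (sample_info J \<Otimes>\<^sub>M \<pi>)"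
proof -
  have "(\<lambda>x. (xi j (fst x), snd x)) \<in> sample_info J \<Otimes>\<^sub>M \<pi> \<rightarrow>\<^sub>M borel \<Otimes>\<^sub>M \<pi>"
    by (intro measurable_Pair measurable_compose[OF measurable_fst xi_adapted[OF assms]] measurable_snd)
  from measurable_compose[OF this gradf_measurable] show ?thesis by simp
qed

text \<open>The difference at level \<open>l\<close> is formed at \<open>xi l\<close> and at the iterate of a lower level, so the samples
  drawn before iteration \<open>l\<close> determine it as a function of \<open>t\<close>.\<close>

lemma Delta_adapted:
  assumes "l \<in> L k" "drawn_before L N l \<subseteq> J"
  shows "(\<lambda>x. mice_Delta L gradf xi l k (fst x) (snd x)) \<in> borel_measurable (sample_info J \<Otimes>\<^sub>M \<pi>)"
proof (cases "l > Min (L k)")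
  case True
  have "drawn_before L N (prev_level L k l) \<subseteq> J"
    using drawn_before_mono[of "prev_level L k l" l] prev_level_less[OF assms(1) True] assms(2) by auto
  then show ?thesis
    using True gradf_adapted assms(2) by (simp add: mice_Delta_def level_diff_def)
next
  case False
  then show ?thesis
    using gradf_adapted assms(2) by (simp add: mice_Delta_def level_diff_def)
qed

lemma fresh_sample_level: "fresh_sample M (sample_info (drawn_before L N l)) \<pi> (\<theta> l \<alpha>)"
  by (rule fresh_sample_outside) (auto dest: drawn_before_level)

lemma Delta_measurable:
  assumes "l \<in> L k"
  shows "(\<lambda>x. mice_Delta L gradf xi l k (fst x) (snd x)) \<in> borel_measurable (M \<Otimes>\<^sub>M \<pi>)"
  by (rule fresh_sample.measurable_pair_fine[OF fresh_sample_level Delta_adapted[OF assms order_refl]])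

lemma Delta_component_square_integrable:
  assumes l: "l \<in> L k" and i: "i \<in> Basis"
  shows "integrable (M \<Otimes>\<^sub>M \<pi>) (\<lambda>x. (mice_Delta L gradf xi l k (fst x) (snd x) \<bullet> i)\<^sup>2)"
proof (rule Bochner_Integration.integrable_bound)
  let ?G = "\<lambda>j x. (norm (gradf (xi j (fst x)) (snd x)))\<^sup>2" and ?p = "prev_level L k l"
  have "integrable (M \<Otimes>\<^sub>M \<pi>) (?G j)" for j
    using gradf_square_integrable[of j] by (simp add: case_prod_unfold)
  then show "integrable (M \<Otimes>\<^sub>M \<pi>) (\<lambda>x. 2 * (?G l x + ?G ?p x))" by simp
  show "(\<lambda>x. (mice_Delta L gradf xi l k (fst x) (snd x) \<bullet> i)\<^sup>2) \<in> borel_measurable (M \<Otimes>\<^sub>M \<pi>)"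
    using Delta_measurable[OF l] by simp
  have "((a - b) \<bullet> i)\<^sup>2 \<le> 2 * ((norm a)\<^sup>2 + (norm b)\<^sup>2)" "(a \<bullet> i)\<^sup>2 \<le> 2 * ((norm a)\<^sup>2 + (norm b)\<^sup>2)" for a b :: 'a
  proof -
    have comp: "(c \<bullet> i)\<^sup>2 \<le> (norm c)\<^sup>2" for c :: 'a
      using Basis_le_norm[OF i, of c] by (metis abs_le_square_iff abs_norm_cancel)
    have "(norm (a - b))\<^sup>2 \<le> (norm a + norm b)\<^sup>2" by (intro power_mono norm_triangle_ineq4) simp
    also have "\<dots> \<le> 2 * ((norm a)\<^sup>2 + (norm b)\<^sup>2)"
      using sum_squares_bound[of "norm a" "norm b"] by (simp add: power2_sum)
    finally show "((a - b) \<bullet> i)\<^sup>2 \<le> 2 * ((norm a)\<^sup>2 + (norm b)\<^sup>2)" using comp[of "a - b"] by linarith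
    have "r \<le> 2 * (r + s)" if "0 \<le> r" "0 \<le> s" for r s :: real using that by simp
    from order_trans[OF comp this] show "(a \<bullet> i)\<^sup>2 \<le> 2 * ((norm a)\<^sup>2 + (norm b)\<^sup>2)" by simp
  qed
  then show "AE x in M \<Otimes>\<^sub>M \<pi>. norm ((mice_Delta L gradf xi l k (fst x) (snd x) \<bullet> i)\<^sup>2)
      \<le> norm (2 * (?G l x + ?G ?p x))"
    by (cases "l > Min (L k)") (simp_all add: mice_Delta_def level_diff_def)
qed

lemma integrable_Delta: "integrable \<pi> (mice_Delta L gradf xi l k \<omega>)"
  using gradf_integrable by (cases "l > Min (L k)") (simp_all add: mice_Delta_def[abs_def] level_diff_def)

lemma integral_Delta: "(\<integral>t. mice_Delta L gradf xi l k \<omega> t \<partial>\<pi>) = mice_mu L gradF xi l k \<omega>"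
  using gradf_integrable by (simp add: mice_Delta_def mice_mu_def level_diff_def gradF_eq)

text \<open>At \<open>(\<omega>, \<theta> l \<alpha> \<omega>)\<close> this is the centred contribution of an actual sample; over \<open>M \<Otimes>\<^sub>M \<pi>\<close> its second
  argument is a draw independent of the iterates. Decoupling passes from the first reading to the second.\<close>

definition centred_Delta :: "nat \<Rightarrow> nat \<Rightarrow> 'a \<Rightarrow> 'w \<times> 't \<Rightarrow> real" where
  "centred_Delta l k i x =
    (mice_Delta L gradf xi l k (fst x) (snd x) - mice_mu L gradF xi l k (fst x)) \<bullet> i"

lemma centred_Delta_mean: "(\<integral>t. centred_Delta l k i (\<omega>, t) \<partial>\<pi>) = 0"
proof -
  interpret law: prob_space \<pi> by (rule prob_space_pi)
  show ?thesis
    using integrable_Delta[of l k \<omega>] integral_Delta[of l k \<omega>]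
    by (simp add: centred_Delta_def inner_diff_left law.prob_space)
qed

lemma mice_V_eq: "mice_V L \<pi> gradf xi l k \<omega> = (\<Sum>i\<in>Basis. \<integral>t. (centred_Delta l k i (\<omega>, t))\<^sup>2 \<partial>\<pi>)"
  using integrable_Delta[of l k \<omega>] integral_Delta[of l k \<omega>]
  by (simp add: mice_V_def centred_Delta_def inner_diff_left)

lemma centred_Delta_adapted:
  assumes "l \<in> L k" "drawn_before L N l \<subseteq> J"
  shows "centred_Delta l k i \<in> borel_measurable (sample_info J \<Otimes>\<^sub>M \<pi>)"
proof -
  interpret law: prob_space \<pi> by (rule prob_space_pi)
  have [measurable]: "(\<lambda>x. mice_Delta L gradf xi l k (fst x) (snd x)) \<in> borel_measurable (sample_info J \<Otimes>\<^sub>M \<pi>)"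
    by (rule Delta_adapted[OF assms])
  have "(\<lambda>\<omega>. \<integral>t. mice_Delta L gradf xi l k \<omega> t \<partial>\<pi>) \<in> borel_measurable (sample_info J)"
    by (rule law.borel_measurable_lebesgue_integral) (simp add: case_prod_beta)
  then have [measurable]: "mice_mu L gradF xi l k \<in> borel_measurable (sample_info J)"
    by (simp add: integral_Delta)
  show ?thesis unfolding centred_Delta_def[abs_def] by measurable
qed

text \<open>For fixed iterates, centring only lowers the second moment. Integrability over the product space
  then follows by Tonelli.\<close>

lemma centred_Delta_square_integrable:
  assumes l: "l \<in> L k" and i: "i \<in> Basis"
  shows "integrable (M \<Otimes>\<^sub>M \<pi>) (\<lambda>x. (centred_Delta l k i x)\<^sup>2)"
proof -
  interpret law: prob_space \<pi> by (rule prob_space_pi)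
  interpret pair_sigma_finite M \<pi> by unfold_locales
  let ?D = "\<lambda>x. mice_Delta L gradf xi l k (fst x) (snd x) \<bullet> i" and ?m = "\<lambda>\<omega>. mice_mu L gradF xi l k \<omega> \<bullet> i"
  have D2: "integrable (M \<Otimes>\<^sub>M \<pi>) (\<lambda>x. (?D x)\<^sup>2)" by (rule Delta_component_square_integrable[OF l i])
  have C: "centred_Delta l k i \<in> borel_measurable (M \<Otimes>\<^sub>M \<pi>)"
    by (rule fresh_sample.measurable_pair_fine[OF fresh_sample_level centred_Delta_adapted[OF l order_refl]])
  have D: "?D \<in> borel_measurable (M \<Otimes>\<^sub>M \<pi>)" using Delta_measurable[OF l] by simp
  show ?thesis
  proof (rule Fubini_integrable)
    show "(\<lambda>x. (centred_Delta l k i x)\<^sup>2) \<in> borel_measurable (M \<Otimes>\<^sub>M \<pi>)" using C by simp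
    have D2_fst: "AE \<omega> in M. integrable \<pi> (\<lambda>t. (?D (\<omega>, t))\<^sup>2)" by (rule AE_integrable_fst'[OF D2])
    have sq: "(centred_Delta l k i (\<omega>, t))\<^sup>2 = (?D (\<omega>, t))\<^sup>2 - 2 * ?m \<omega> * ?D (\<omega>, t) + (?m \<omega>)\<^sup>2" for \<omega> t
      by (simp add: centred_Delta_def inner_diff_left power2_diff algebra_simps)
    have D_int: "integrable \<pi> (\<lambda>t. ?D (\<omega>, t))" for \<omega> using integrable_Delta[of l k \<omega>] by simp
    have D_mean: "(\<integral>t. ?D (\<omega>, t) \<partial>\<pi>) = ?m \<omega>" for \<omega>
      using integral_Delta[of l k \<omega>] integrable_Delta[of l k \<omega>] by simp
    show "AE \<omega> in M. integrable \<pi> (\<lambda>t. (centred_Delta l k i (\<omega>, t))\<^sup>2)"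
      using D2_fst by eventually_elim (use D_int in \<open>simp add: sq\<close>)
    show "integrable M (\<lambda>\<omega>. \<integral>t. norm ((centred_Delta l k i (\<omega>, t))\<^sup>2) \<partial>\<pi>)"
    proof (rule Bochner_Integration.integrable_bound)
      show "integrable M (\<lambda>\<omega>. \<integral>t. (?D (\<omega>, t))\<^sup>2 \<partial>\<pi>)" by (rule integrable_fst'[OF D2])
      show "(\<lambda>\<omega>. \<integral>t. norm ((centred_Delta l k i (\<omega>, t))\<^sup>2) \<partial>\<pi>) \<in> borel_measurable M"
        using C by (intro law.borel_measurable_lebesgue_integral) simp
      show "AE \<omega> in M. norm (\<integral>t. norm ((centred_Delta l k i (\<omega>, t))\<^sup>2) \<partial>\<pi>) \<le> norm (\<integral>t. (?D (\<omega>, t))\<^sup>2 \<partial>\<pi>)"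
        using D2_fst
      proof eventually_elim
        case (elim \<omega>)
        have "(\<integral>t. (centred_Delta l k i (\<omega>, t))\<^sup>2 \<partial>\<pi>) = (\<integral>t. (?D (\<omega>, t))\<^sup>2 \<partial>\<pi>) - (?m \<omega>)\<^sup>2"
          unfolding sq using elim D_int[of \<omega>] D_mean[of \<omega>]
          by (simp add: law.prob_space) (simp add: power2_eq_square)
        then have "(\<integral>t. (centred_Delta l k i (\<omega>, t))\<^sup>2 \<partial>\<pi>) \<le> (\<integral>t. (?D (\<omega>, t))\<^sup>2 \<partial>\<pi>)" by simp
        then show ?case by simp
      qed
    qed
  qed
qed

section \<open>The bias as the error of the inherited samples\<close>

lemma Delta_sample_adapted:
  assumes "l \<in> L k" "drawn_before L N l \<subseteq> J" "(l, \<alpha>) \<in> J"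
  shows "(\<lambda>\<omega>. mice_Delta L gradf xi l k \<omega> (\<theta> l \<alpha> \<omega>)) \<in> borel_measurable (sample_info J)"
    and "(\<lambda>\<omega>. centred_Delta l k i (\<omega>, \<theta> l \<alpha> \<omega>)) \<in> borel_measurable (sample_info J)"
proof -
  have pair: "(\<lambda>\<omega>. (\<omega>, \<theta> l \<alpha> \<omega>)) \<in> sample_info J \<rightarrow>\<^sub>M sample_info J \<Otimes>\<^sub>M \<pi>"
    by (intro measurable_Pair measurable_ident_sets refl sample_info_theta assms)
  show "(\<lambda>\<omega>. mice_Delta L gradf xi l k \<omega> (\<theta> l \<alpha> \<omega>)) \<in> borel_measurable (sample_info J)"
    using measurable_compose[OF pair Delta_adapted[OF assms(1,2)]] by simp
  show "(\<lambda>\<omega>. centred_Delta l k i (\<omega>, \<theta> l \<alpha> \<omega>)) \<in> borel_measurable (sample_info J)"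
    using measurable_compose[OF pair centred_Delta_adapted[OF assms(1,2)]] .
qed

lemma Delta_component_integrable:
  assumes "l \<in> L k" "i \<in> Basis"
  shows "integrable (M \<Otimes>\<^sub>M \<pi>) (\<lambda>x. mice_Delta L gradf xi l k (fst x) (snd x) \<bullet> i)"
proof -
  interpret law: prob_space \<pi> by (rule prob_space_pi)
  interpret joint: pair_prob_space M \<pi> by unfold_locales
  have "(\<lambda>x. mice_Delta L gradf xi l k (fst x) (snd x) \<bullet> i) \<in> borel_measurable (M \<Otimes>\<^sub>M \<pi>)"
    using Delta_measurable[OF assms(1)] by simp
  from joint.square_integrable_imp_integrable[OF this Delta_component_square_integrable[OF assms]]
  show ?thesis .
qed

lemma Delta_sample_integrable:
  assumes "l \<in> L k" "i \<in> Basis"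
  shows "integrable M (\<lambda>\<omega>. mice_Delta L gradf xi l k \<omega> (\<theta> l \<alpha> \<omega>) \<bullet> i)"
proof -
  interpret fresh_sample M "sample_info (drawn_before L N l)" \<pi> "\<theta> l \<alpha>"
    by (rule fresh_sample_level)
  have "(\<lambda>x. mice_Delta L gradf xi l k (fst x) (snd x) \<bullet> i)
      \<in> borel_measurable (sample_info (drawn_before L N l) \<Otimes>\<^sub>M \<pi>)"
    using Delta_adapted[OF assms(1) order_refl] by simp
  from integrable_sample_iff[OF this] show ?thesis
    using Delta_component_integrable[OF assms] by simp
qed

text \<open>All iterates up to \<open>xi k\<close> are known given the history, so a sample is either known as well or fresh.\<close>

lemma cond_exp_Delta_sample:
  assumes l: "l \<in> L k" and i: "i \<in> Basis"
  shows "AE \<omega> in M. real_cond_exp M (history M L N \<pi> \<theta> xi k)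
      (\<lambda>\<omega>. mice_Delta L gradf xi l k \<omega> (\<theta> l \<alpha> \<omega>) \<bullet> i) \<omega>
    = (if (l, \<alpha>) \<in> drawn_before L N k then mice_Delta L gradf xi l k \<omega> (\<theta> l \<alpha> \<omega>) \<bullet> i
       else mice_mu L gradF xi l k \<omega> \<bullet> i)"
proof -
  let ?J = "drawn_before L N k"
  have J: "drawn_before L N l \<subseteq> ?J" by (rule drawn_before_mono[OF L_le[OF l]])
  show ?thesis
  proof (cases "(l, \<alpha>) \<in> ?J")
    case True
    interpret finite_measure_subalgebra M "sample_info ?J"
      by unfold_locales (rule subalgebra_sample_info)
    have "(\<lambda>\<omega>. mice_Delta L gradf xi l k \<omega> (\<theta> l \<alpha> \<omega>) \<bullet> i) \<in> borel_measurable (sample_info ?J)"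
      using Delta_sample_adapted(1)[OF l J True] by simp
    from real_cond_exp_F_meas[OF Delta_sample_integrable[OF l i] this]
    show ?thesis using True by (simp add: history_eq_sample_info)
  next
    case False
    interpret fresh_sample M "sample_info ?J" \<pi> "\<theta> l \<alpha>"
      by (rule fresh_sample_outside[OF False])
    have "(\<lambda>x. mice_Delta L gradf xi l k (fst x) (snd x) \<bullet> i) \<in> borel_measurable (sample_info ?J \<Otimes>\<^sub>M \<pi>)"
      using Delta_adapted[OF l J] by simp
    from cond_exp_sample[OF this Delta_component_integrable[OF l i]]
    show ?thesis
      using False integrable_Delta integral_Delta[of l k]
      by (simp add: history_eq_sample_info)
  qed
qed

text \<open>The samples used at iteration \<open>Suc m\<close> that have been drawn earlier, by \<open>drawn_before_Suc_iff\<close>.\<close>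

definition past_samples :: "nat \<Rightarrow> (nat \<times> nat) set" where
  "past_samples m = (SIGMA l:L (Suc m) \<inter> L m. {..<N l m})"

lemma finite_past_samples: "finite (past_samples m)"
  using finite_L by (simp add: past_samples_def)

text \<open>The component along \<open>i\<close> of the claimed bias, written as one sum over all old samples; this is the
  form in which the summands are orthogonal.\<close>

definition inherited_error :: "nat \<Rightarrow> 'a \<Rightarrow> 'w \<Rightarrow> real" where
  "inherited_error m i \<omega> =
    (\<Sum>(l, \<alpha>)\<in>past_samples m. 1 / real (N l (Suc m)) * centred_Delta l m i (\<omega>, \<theta> l \<alpha> \<omega>))"

text \<open>In the estimator minus the telescoped target, each new sample contributes its conditional mean minus
  that mean, and only the old samples are left.\<close>

lemma bias_component:
  assumes keep: "\<And>l \<omega> t. l \<in> L (Suc m) \<inter> L m \<Longrightarrow> \<omega> \<in> space M \<Longrightarrow> t \<in> space \<pi> \<Longrightarrow>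
      mice_Delta L gradf xi l (Suc m) \<omega> t = mice_Delta L gradf xi l m \<omega> t"
    and i: "i \<in> Basis"
  shows "AE \<omega> in M. mice_bias M \<pi> L N gradf gradF \<theta> xi (Suc m) \<omega> \<bullet> i =
    inherited_error m i \<omega>"
proof -
  let ?k = "Suc m" and ?H = "history M L N \<pi> \<theta> xi (Suc m)"
  let ?J = "drawn_before L N ?k"
  interpret finite_measure_subalgebra M ?H
    by unfold_locales (simp add: history_eq_sample_info subalgebra_sample_info)
  define S where "S = (SIGMA l:L ?k. {..<N l ?k})"
  define c where "c p = 1 / real (N (fst p) ?k)" for p :: "nat \<times> nat"
  define D where "D p \<omega> = mice_Delta L gradf xi (fst p) ?k \<omega> (\<theta> (fst p) (snd p) \<omega>) \<bullet> i" for p \<omega>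
  define \<mu> where "\<mu> p \<omega> = mice_mu L gradF xi (fst p) ?k \<omega> \<bullet> i" for p :: "nat \<times> nat" and \<omega>
  have S: "finite S" "\<And>p. p \<in> S \<Longrightarrow> fst p \<in> L ?k" using finite_L by (auto simp: S_def)
  have sum_S: "(\<Sum>p\<in>S. c p * g p) = (\<Sum>l\<in>L ?k. 1 / real (N l ?k) * (\<Sum>\<alpha><N l ?k. g (l, \<alpha>)))"
    for g :: "nat \<times> nat \<Rightarrow> real"
    using sum.Sigma[of "L ?k" "\<lambda>l. {..<N l ?k}" "\<lambda>l \<alpha>. 1 / real (N l ?k) * g (l, \<alpha>)"] finite_L
    by (simp add: S_def c_def sum_distrib_left case_prod_beta)
  have estimator: "mice_estimator L N gradf \<theta> xi ?k \<omega> \<bullet> i = (\<Sum>p\<in>S. c p * D p \<omega>)" for \<omega>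
    unfolding sum_S
    by (simp add: mice_estimator_def mice_mu_hat_def inner_sum_left D_def)
  have target: "gradF (xi ?k \<omega>) \<bullet> i = (\<Sum>p\<in>S. c p * \<mu> p \<omega>)" for \<omega>
  proof -
    have "gradF (xi ?k \<omega>) = (\<Sum>l\<in>L ?k. mice_mu L gradF xi l ?k \<omega>)"
      unfolding mice_mu_def by (rule sum_level_diff[symmetric])
    also have "\<dots> \<bullet> i = (\<Sum>p\<in>S. c p * \<mu> p \<omega>)"
      unfolding sum_S inner_sum_left \<mu>_def using N_pos[of _ ?k] by (intro sum.cong refl) simp
    finally show ?thesis .
  qed
  \<comment> \<open>Old samples stay, new samples are replaced by their mean.\<close>
  have "AE \<omega> in M. real_cond_exp M ?H (\<lambda>\<omega>. \<Sum>p\<in>S. c p * D p \<omega>) \<omega>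
      = (\<Sum>p\<in>S. c p * (if p \<in> ?J then D p \<omega> else \<mu> p \<omega>))"
  proof (rule real_cond_exp_linear_combination[OF S(1)])
    fix p assume "p \<in> S"
    then have p: "fst p \<in> L ?k" by (rule S(2))
    show "integrable M (D p)"
      unfolding D_def[abs_def] by (rule Delta_sample_integrable[OF p i])
    show "AE \<omega> in M. real_cond_exp M ?H (D p) \<omega> = (if p \<in> ?J then D p \<omega> else \<mu> p \<omega>)"
      using cond_exp_Delta_sample[OF p i, of "snd p"] unfolding D_def[abs_def] \<mu>_def prod.collapse .
  qed
  then show ?thesis
    using AE_space
  proof eventually_elim
    case (elim \<omega>)
    have "mice_bias M \<pi> L N gradf gradF \<theta> xi ?k \<omega> \<bullet> i
        = real_cond_exp M ?H (\<lambda>\<omega>'. mice_estimator L N gradf \<theta> xi ?k \<omega>' \<bullet> i) \<omega> - gradF (xi ?k \<omega>) \<bullet> i"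
      using i by (simp add: mice_bias_def vec_cond_exp_def inner_diff_left inner_sum_left_Basis)
    also have "\<dots> = (\<Sum>p\<in>S. c p * (if p \<in> ?J then D p \<omega> - \<mu> p \<omega> else 0))"
      unfolding estimator target elim(1) sum_subtractf[symmetric]
      by (intro sum.cong refl) (simp add: right_diff_distrib)
    also have "\<dots> = (\<Sum>p\<in>past_samples m. c p * centred_Delta (fst p) m i (\<omega>, \<theta> (fst p) (snd p) \<omega>))"
    proof (rule sum.mono_neutral_cong_right[OF S(1)])
      show sub: "past_samples m \<subseteq> S"
        using N_mono[of ?k] by (fastforce simp: past_samples_def S_def)
      have in_J: "p \<in> ?J \<longleftrightarrow> p \<in> past_samples m" if "p \<in> S" for p
        using drawn_before_Suc_iff[of "fst p" m "snd p"] S(2)[OF that]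
        by (cases p) (simp add: past_samples_def)
      show "\<forall>p\<in>S - past_samples m. c p * (if p \<in> ?J then D p \<omega> - \<mu> p \<omega> else 0) = 0"
        using in_J by auto
      fix p assume p: "p \<in> past_samples m"
      then have l: "fst p \<in> L ?k \<inter> L m" by (auto simp: past_samples_def)
      have "mice_mu L gradF xi (fst p) ?k \<omega> = mice_mu L gradF xi (fst p) m \<omega>"
        unfolding integral_Delta[symmetric]
        using keep[OF l elim(2)] by (intro Bochner_Integration.integral_cong refl)
      moreover have "mice_Delta L gradf xi (fst p) ?k \<omega> (\<theta> (fst p) (snd p) \<omega>)
          = mice_Delta L gradf xi (fst p) m \<omega> (\<theta> (fst p) (snd p) \<omega>)"
        by (rule keep[OF l elim(2) theta_space[OF elim(2)]])
      ultimately show "c p * (if p \<in> ?J then D p \<omega> - \<mu> p \<omega> else 0)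
          = c p * centred_Delta (fst p) m i (\<omega>, \<theta> (fst p) (snd p) \<omega>)"
        using in_J[of p] p sub by (auto simp: D_def \<mu>_def centred_Delta_def inner_diff_left)
    qed
    finally show ?case by (simp add: inherited_error_def c_def case_prod_beta)
  qed
qed

lemma inherited_error_component:
  "(\<Sum>l\<in>L (Suc m) \<inter> L m. (real (N l m) / real (N l (Suc m))) *\<^sub>R
      (mice_mu_hat L N gradf \<theta> xi l m \<omega> - mice_mu L gradF xi l m \<omega>)) \<bullet> i
    = inherited_error m i \<omega>"
proof -
  have "real (N l m) / real (N l (Suc m)) * ((mice_mu_hat L N gradf \<theta> xi l m \<omega> - mice_mu L gradF xi l m \<omega>) \<bullet> i)
      = (\<Sum>\<alpha><N l m. 1 / real (N l (Suc m)) * centred_Delta l m i (\<omega>, \<theta> l \<alpha> \<omega>))"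
    if "l \<in> L (Suc m) \<inter> L m" for l
  proof -
    have "real (N l m) * ((mice_mu_hat L N gradf \<theta> xi l m \<omega> - mice_mu L gradF xi l m \<omega>) \<bullet> i)
        = (\<Sum>\<alpha><N l m. centred_Delta l m i (\<omega>, \<theta> l \<alpha> \<omega>))"
      using N_pos[of l m] that
      by (simp add: mice_mu_hat_def centred_Delta_def inner_diff_left inner_sum_left sum_subtractf right_diff_distrib)
    then show ?thesis by (simp add: sum_divide_distrib[symmetric])
  qed
  then show ?thesis
    unfolding inherited_error_def past_samples_def using finite_L
    by (subst sum.Sigma[symmetric]) (auto simp: inner_sum_left intro!: sum.cong)
qed

section \<open>Orthogonality and the second moment of the bias\<close>

lemma centred_Delta_sample_square_integrable:
  assumes l: "l \<in> L m" and i: "i \<in> Basis"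
  shows "integrable M (\<lambda>\<omega>. (centred_Delta l m i (\<omega>, \<theta> l \<alpha> \<omega>))\<^sup>2)"
    and "(\<integral>\<omega>. (centred_Delta l m i (\<omega>, \<theta> l \<alpha> \<omega>))\<^sup>2 \<partial>M)
      = (\<integral>\<omega>. (\<integral>t. (centred_Delta l m i (\<omega>, t))\<^sup>2 \<partial>\<pi>) \<partial>M)"
proof -
  interpret fresh_sample M "sample_info (drawn_before L N l)" \<pi> "\<theta> l \<alpha>"
    by (rule fresh_sample_level)
  have meas: "(\<lambda>x. (centred_Delta l m i x)\<^sup>2) \<in> borel_measurable (sample_info (drawn_before L N l) \<Otimes>\<^sub>M \<pi>)"
    using centred_Delta_adapted[OF l order_refl] by simp
  note int = centred_Delta_square_integrable[OF l i]
  show "integrable M (\<lambda>\<omega>. (centred_Delta l m i (\<omega>, \<theta> l \<alpha> \<omega>))\<^sup>2)"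
    using integrable_sample_iff[OF meas] int by simp
  show "(\<integral>\<omega>. (centred_Delta l m i (\<omega>, \<theta> l \<alpha> \<omega>))\<^sup>2 \<partial>M)
      = (\<integral>\<omega>. (\<integral>t. (centred_Delta l m i (\<omega>, t))\<^sup>2 \<partial>\<pi>) \<partial>M)"
    by (rule integral_sample_iterated[OF meas int])
qed

text \<open>Measurability is read off in the \<open>\<sigma>\<close>-algebra of all samples, where \<open>\<theta> l \<alpha>\<close> is among the data.\<close>

lemma centred_Delta_sample_measurable:
  assumes "l \<in> L m"
  shows "(\<lambda>\<omega>. centred_Delta l m i (\<omega>, \<theta> l \<alpha> \<omega>)) \<in> borel_measurable M"
proof (rule measurable_from_subalg[OF subalgebra_sample_info])
  show "(\<lambda>\<omega>. centred_Delta l m i (\<omega>, \<theta> l \<alpha> \<omega>)) \<in> borel_measurable (sample_info UNIV)"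
    by (rule Delta_sample_adapted(2)[OF assms]) auto
qed

text \<open>The sample of the higher level, \<open>a\<close>, is fresh for the information in the initial iterate and in all
  other samples of levels up to \<open>a\<close>. That information contains the iterates in the difference at level
  \<open>a\<close>, which involve only samples of levels below \<open>a\<close>, as well as the whole other factor. Two samples
  of the same level are covered too.\<close>

lemma centred_Delta_orthogonal:
  assumes l: "l \<in> L m" and l': "l' \<in> L m" and i: "i \<in> Basis" and ne: "(l, \<alpha>) \<noteq> (l', \<alpha>')"
  shows "(\<integral>\<omega>. centred_Delta l m i (\<omega>, \<theta> l \<alpha> \<omega>) * centred_Delta l' m i (\<omega>, \<theta> l' \<alpha>' \<omega>) \<partial>M) = 0"
proof -
  have later: "(\<integral>\<omega>. centred_Delta b m i (\<omega>, \<theta> b \<beta> \<omega>) * centred_Delta a m i (\<omega>, \<theta> a \<alpha> \<omega>) \<partial>M) = 0"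
    if a: "a \<in> L m" and b: "b \<in> L m" and ab: "b \<le> a" "(a, \<alpha>) \<noteq> (b, \<beta>)" for a b \<alpha> \<beta>
  proof -
    define J where "J = {p. fst p \<le> a} - {(a, \<alpha>)}"
    interpret fresh_sample M "sample_info J" \<pi> "\<theta> a \<alpha>"
      by (rule fresh_sample_outside) (simp add: J_def)
    have J: "drawn_before L N j \<subseteq> J" if "j \<le> a" for j
      using that drawn_before_level[of _ j] by (fastforce simp: J_def)
    show ?thesis
    proof (rule integral_sample_centred)
      show "centred_Delta a m i \<in> borel_measurable (sample_info J \<Otimes>\<^sub>M \<pi>)"
        by (rule centred_Delta_adapted[OF a J[OF order_refl]])
      show "(\<lambda>\<omega>. centred_Delta b m i (\<omega>, \<theta> b \<beta> \<omega>)) \<in> borel_measurable (sample_info J)"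
        using ab by (intro Delta_sample_adapted(2)[OF b J[OF ab(1)]]) (auto simp: J_def)
    qed (rule centred_Delta_sample_square_integrable(1)[OF a i]
        centred_Delta_sample_square_integrable(1)[OF b i] centred_Delta_mean)+
  qed
  show ?thesis
  proof (cases "l' \<le> l")
    case True
    from later[OF l l' this ne] show ?thesis by (simp add: mult.commute)
  next
    case False
    from later[OF l' l, of \<alpha>' \<alpha>] False ne show ?thesis by auto
  qed
qed

lemma second_moment_component:
  assumes i: "i \<in> Basis"
  shows "integrable M (\<lambda>\<omega>. (inherited_error m i \<omega>)\<^sup>2)"
    and "(\<integral>\<omega>. (inherited_error m i \<omega>)\<^sup>2 \<partial>M) = (\<Sum>l\<in>L (Suc m) \<inter> L m. real (N l m) / (real (N l (Suc m)))\<^sup>2 *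
      (\<integral>\<omega>. (\<integral>t. (centred_Delta l m i (\<omega>, t))\<^sup>2 \<partial>\<pi>) \<partial>M))"
proof -
  define c where "c p = 1 / real (N (fst p) (Suc m))" for p :: "nat \<times> nat"
  define Z where "Z p \<omega> = centred_Delta (fst p) m i (\<omega>, \<theta> (fst p) (snd p) \<omega>)" for p \<omega>
  have e: "inherited_error m i \<omega> = (\<Sum>p\<in>past_samples m. c p * Z p \<omega>)" for \<omega>
    by (simp add: inherited_error_def c_def Z_def case_prod_beta)
  have level: "fst p \<in> L m" if "p \<in> past_samples m" for p using that by (auto simp: past_samples_def)
  have Z_meas: "Z p \<in> borel_measurable M" and Z_sq: "integrable M (\<lambda>\<omega>. (Z p \<omega>)\<^sup>2)"
    if "p \<in> past_samples m" for p
    unfolding Z_def[abs_def] using level[OF that]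
    by (auto intro!: centred_Delta_sample_measurable centred_Delta_sample_square_integrable(1) i)
  have Z_orth: "(\<integral>\<omega>. Z p \<omega> * Z q \<omega> \<partial>M) = 0" if "p \<in> past_samples m" "q \<in> past_samples m" "p \<noteq> q" for p q
    unfolding Z_def using that
    by (intro centred_Delta_orthogonal level i) (auto simp: prod_eq_iff)
  note pythagoras = finite_past_samples Z_meas Z_sq Z_orth
  show "integrable M (\<lambda>\<omega>. (inherited_error m i \<omega>)\<^sup>2)"
    unfolding e by (rule integrable_square_sum_orthogonal[OF pythagoras])
  have "(\<integral>\<omega>. (inherited_error m i \<omega>)\<^sup>2 \<partial>M) = (\<Sum>p\<in>past_samples m. (c p)\<^sup>2 * (\<integral>\<omega>. (Z p \<omega>)\<^sup>2 \<partial>M))"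
    unfolding e by (rule integral_square_sum_orthogonal[OF pythagoras])
  also have "\<dots> = (\<Sum>p\<in>past_samples m. (c p)\<^sup>2 * (\<integral>\<omega>. (\<integral>t. (centred_Delta (fst p) m i (\<omega>, t))\<^sup>2 \<partial>\<pi>) \<partial>M))"
    unfolding Z_def using level by (intro sum.cong refl) (simp add: centred_Delta_sample_square_integrable(2) i)
  also have "\<dots> = (\<Sum>l\<in>L (Suc m) \<inter> L m. \<Sum>\<alpha><N l m.
      (1 / real (N l (Suc m)))\<^sup>2 * (\<integral>\<omega>. (\<integral>t. (centred_Delta l m i (\<omega>, t))\<^sup>2 \<partial>\<pi>) \<partial>M))"
    unfolding past_samples_def c_def using finite_L
    by (subst sum.Sigma) (auto simp: case_prod_beta)
  also have "\<dots> = (\<Sum>l\<in>L (Suc m) \<inter> L m. real (N l m) / (real (N l (Suc m)))\<^sup>2 *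
      (\<integral>\<omega>. (\<integral>t. (centred_Delta l m i (\<omega>, t))\<^sup>2 \<partial>\<pi>) \<partial>M))"
    by (intro sum.cong refl) (simp add: power_divide)
  finally show "(\<integral>\<omega>. (inherited_error m i \<omega>)\<^sup>2 \<partial>M) = \<dots>" .
qed

lemma integrable_variance:
  assumes "l \<in> L m" "i \<in> Basis"
  shows "integrable M (\<lambda>\<omega>. \<integral>t. (centred_Delta l m i (\<omega>, t))\<^sup>2 \<partial>\<pi>)"
  by (rule pair_sigma_finite.integrable_fst'[OF fresh_sample.pair_sigma_finite_law[OF fresh_sample_level]
      centred_Delta_square_integrable[OF assms]])

end

text \<open>The conditional expectation is only determined up to null sets, separately for each component; the
  finitely many exceptional sets are merged before the components are put together.\<close>

theorem proposition3:
  fixes M :: "'w measure" and \<pi> :: "'t measure"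
    and f :: "'a::euclidean_space \<Rightarrow> 't \<Rightarrow> real"
    and gradf :: "'a \<Rightarrow> 't \<Rightarrow> 'a" and gradF :: "'a \<Rightarrow> 'a"
    and L :: "nat \<Rightarrow> nat set" and N :: "nat \<Rightarrow> nat \<Rightarrow> nat"
    and \<theta> :: "nat \<Rightarrow> nat \<Rightarrow> 'w \<Rightarrow> 't" and xi :: "nat \<Rightarrow> 'w \<Rightarrow> 'a"
    and k :: nat
  assumes setting: "mice_setting M \<pi> f gradf gradF L N \<theta> xi"
    and k: "1 \<le> k"
    and keep: "\<And>l \<omega> t. l \<in> L k \<inter> L (k - 1) \<Longrightarrow> \<omega> \<in> space M \<Longrightarrow> t \<in> space \<pi> \<Longrightarrow>
      mice_Delta L gradf xi l k \<omega> t = mice_Delta L gradf xi l (k - 1) \<omega> t"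
  shows "(AE \<omega> in M. mice_bias M \<pi> L N gradf gradF \<theta> xi k \<omega> =
      (\<Sum>l\<in>L k \<inter> L (k - 1). (real (N l (k - 1)) / real (N l k)) *\<^sub>R
        (mice_mu_hat L N gradf \<theta> xi l (k - 1) \<omega> - mice_mu L gradF xi l (k - 1) \<omega>)))
    \<and> (\<integral>\<omega>. (norm (mice_bias M \<pi> L N gradf gradF \<theta> xi k \<omega>))\<^sup>2 \<partial>M) =
      (\<integral>\<omega>. (\<Sum>l\<in>L k \<inter> L (k - 1). real (N l (k - 1)) / (real (N l k))\<^sup>2 *
        mice_V L \<pi> gradf xi l (k - 1) \<omega>) \<partial>M)"
proof -
  interpret mice_setting M \<pi> f gradf gradF L N \<theta> xi by (rule setting)
  obtain m where km: "k = Suc m" using k by (cases k) auto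
  let ?b = "mice_bias M \<pi> L N gradf gradF \<theta> xi (Suc m)"
  have components: "AE \<omega> in M. \<forall>i\<in>Basis. ?b \<omega> \<bullet> i = inherited_error m i \<omega>"
    using keep by (intro AE_finite_allI bias_component) (auto simp: km)
  have "AE \<omega> in M. ?b \<omega> = (\<Sum>l\<in>L (Suc m) \<inter> L m. (real (N l m) / real (N l (Suc m))) *\<^sub>R
      (mice_mu_hat L N gradf \<theta> xi l m \<omega> - mice_mu L gradF xi l m \<omega>))"
    using components
    by eventually_elim (rule euclidean_eqI, simp add: inherited_error_component)
  moreover have "(\<integral>\<omega>. (norm (?b \<omega>))\<^sup>2 \<partial>M)
      = (\<integral>\<omega>. (\<Sum>l\<in>L (Suc m) \<inter> L m. real (N l m) / (real (N l (Suc m)))\<^sup>2 * mice_V L \<pi> gradf xi l m \<omega>) \<partial>M)"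
  proof -
    let ?v = "\<lambda>l i \<omega>. \<integral>t. (centred_Delta l m i (\<omega>, t))\<^sup>2 \<partial>\<pi>"
    let ?w = "\<lambda>l. real (N l m) / (real (N l (Suc m)))\<^sup>2"
    have norm_b: "(norm (?b \<omega>))\<^sup>2 = (\<Sum>i\<in>Basis. (?b \<omega> \<bullet> i)\<^sup>2)" for \<omega>
      unfolding power2_norm_eq_inner by (subst euclidean_inner) (simp add: power2_eq_square)
    have b_meas: "(\<lambda>\<omega>. ?b \<omega> \<bullet> i) \<in> borel_measurable M" if "i \<in> Basis" for i
    proof -
      have "xi (Suc m) \<in> borel_measurable M"
        using xi_adapted[OF order_refl] measurable_from_subalg[OF subalgebra_sample_info] by blast
      moreover have "gradF \<in> borel_measurable borel"
      proof -
        interpret law: prob_space \<pi> by (rule prob_space_pi)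
        have "(\<lambda>x. \<integral>t. gradf x t \<partial>\<pi>) \<in> borel_measurable borel"
          using gradf_measurable by (intro law.borel_measurable_lebesgue_integral) (simp add: case_prod_beta)
        then show ?thesis by (simp add: gradF_eq[abs_def])
      qed
      ultimately have "(\<lambda>\<omega>. gradF (xi (Suc m) \<omega>)) \<in> borel_measurable M"
        by (rule measurable_compose)
      then show ?thesis
        unfolding mice_bias_def vec_cond_exp_def inner_diff_left inner_sum_left_Basis[OF that] by simp
    qed
    have e_meas: "inherited_error m i \<in> borel_measurable M" for i
      unfolding inherited_error_def[abs_def] 
      by (intro borel_measurable_sum) (auto simp: past_samples_def intro!: borel_measurable_divide centred_Delta_sample_measurable)
    have "(\<integral>\<omega>. (norm (?b \<omega>))\<^sup>2 \<partial>M) = (\<integral>\<omega>. (\<Sum>i\<in>Basis. (inherited_error m i \<omega>)\<^sup>2) \<partial>M)"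
      unfolding norm_b
    proof (rule integral_cong_AE)
      show "AE \<omega> in M. (\<Sum>i\<in>Basis. (?b \<omega> \<bullet> i)\<^sup>2) = (\<Sum>i\<in>Basis. (inherited_error m i \<omega>)\<^sup>2)"
        using components by eventually_elim simp
    qed (use b_meas e_meas in auto)
    also have "\<dots> = (\<Sum>i\<in>Basis. \<integral>\<omega>. (inherited_error m i \<omega>)\<^sup>2 \<partial>M)"
      by (intro Bochner_Integration.integral_sum second_moment_component)
    also have "\<dots> = (\<Sum>i\<in>Basis. \<Sum>l\<in>L (Suc m) \<inter> L m. ?w l * (\<integral>\<omega>. ?v l i \<omega> \<partial>M))"
      by (intro sum.cong refl second_moment_component)
    also have "\<dots> = (\<Sum>l\<in>L (Suc m) \<inter> L m. \<integral>\<omega>. ?w l * (\<Sum>i\<in>Basis. ?v l i \<omega>) \<partial>M)"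
    proof (subst sum.swap, rule sum.cong[OF refl])
      fix l assume l: "l \<in> L (Suc m) \<inter> L m"
      have "(\<integral>\<omega>. (\<Sum>i\<in>Basis. ?v l i \<omega>) \<partial>M) = (\<Sum>i\<in>Basis. \<integral>\<omega>. ?v l i \<omega> \<partial>M)"
        using l by (intro Bochner_Integration.integral_sum integrable_variance) auto
      then show "(\<Sum>i\<in>Basis. ?w l * (\<integral>\<omega>. ?v l i \<omega> \<partial>M)) = (\<integral>\<omega>. ?w l * (\<Sum>i\<in>Basis. ?v l i \<omega>) \<partial>M)"
        unfolding integral_mult_right_zero by (simp add: sum_distrib_left)
    qed
    also have "\<dots> = (\<integral>\<omega>. (\<Sum>l\<in>L (Suc m) \<inter> L m. ?w l * (\<Sum>i\<in>Basis. ?v l i \<omega>)) \<partial>M)"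
      by (intro Bochner_Integration.integral_sum[symmetric] integrable_mult_right
          Bochner_Integration.integrable_sum integrable_variance) auto
    finally show ?thesis by (simp add: mice_V_eq)
  qed
  ultimately show ?thesis by (simp add: km)
qed

end
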